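(* Let $n\ge3$, let $g_1,\ldots,g_n>0$ be pair-sum nonresonant weights, and let $D_t=\operatorname{diag}(t^{g_1},\ldots,t^{g_n})$ for $t>0$. If a connected embedded $C^2$ hypersurface $\Sigma\subset\mathbb R^n$ is minimal and satisfies $D_t\Sigma=\Sigma$ for every $t>0$, then $\Sigma$ is a (relatively) open connected subset of a coordinate hyperplane $\{x\in\mathbb R^n:x_i=0\}$ for some $i\in\{1,\ldots,n\}$.
   Context: Weights $g_1,\ldots,g_n>0$ are pair-sum nonresonant if the $\binom n2$ sums $g_i+g_j$ ($1\le i<j\le n$) are all distinct. A $C^2$ hypersurface is minimal if its Euclidean mean-curvature vector vanishes identically. Hypersurfaces are taken to be nonempty. *)

theory Defs
  imports "HOL-Analysis.Analysis"
begin

(* Intended for open U: derivatives are taken with "at x", not relative to U. *)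
definition C2_on :: "'a set \<Rightarrow> ('a::real_normed_vector \<Rightarrow> 'b::real_normed_vector) \<Rightarrow> bool" where
  "C2_on U f \<longleftrightarrow>
     (\<exists>(f' :: 'a \<Rightarrow> 'a \<Rightarrow>\<^sub>L 'b) (f'' :: 'a \<Rightarrow> 'a \<Rightarrow>\<^sub>L ('a \<Rightarrow>\<^sub>L 'b)).
        (\<forall>x\<in>U. (f has_derivative blinfun_apply (f' x)) (at x)) \<and>
        (\<forall>x\<in>U. (f' has_derivative blinfun_apply (f'' x)) (at x)) \<and>
        continuous_on U f'')"

(* Slice charts: near each of its points, S is carried onto a piece of a coordinate hyperplane
   by a C^2 diffeomorphism \<phi> (with inverse \<psi>) between open subsets of the ambient space.
   S need not be closed. *)
definition embedded_C2_hypersurface :: "'a::euclidean_space set \<Rightarrow> bool" where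
  "embedded_C2_hypersurface S \<longleftrightarrow>
     S \<noteq> {} \<and>
     (\<forall>p\<in>S. \<exists>U (V :: 'a set) \<phi> \<psi>. \<exists>k\<in>Basis.
        open U \<and> p \<in> U \<and> open V \<and>
        homeomorphism U V \<phi> \<psi> \<and> C2_on U \<phi> \<and> C2_on V \<psi> \<and>
        \<phi> ` (S \<inter> U) = {y \<in> V. y \<bullet> k = 0})"

definition C2_curve_at :: "'a::euclidean_space set \<Rightarrow> 'a \<Rightarrow> (real \<Rightarrow> 'a) \<Rightarrow> bool" where
  "C2_curve_at S p \<gamma> \<longleftrightarrow>
     \<gamma> 0 = p \<and> (\<exists>\<epsilon>>0. C2_on {-\<epsilon><..<\<epsilon>} \<gamma> \<and> \<gamma> ` {-\<epsilon><..<\<epsilon>} \<subseteq> S)"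

definition velocity :: "(real \<Rightarrow> 'a::real_normed_vector) \<Rightarrow> real \<Rightarrow> 'a" where
  "velocity \<gamma> s = vector_derivative \<gamma> (at s)"

definition acceleration :: "(real \<Rightarrow> 'a::real_normed_vector) \<Rightarrow> real \<Rightarrow> 'a" where
  "acceleration \<gamma> s = vector_derivative (velocity \<gamma>) (at s)"

definition tangent_space :: "'a::euclidean_space set \<Rightarrow> 'a \<Rightarrow> 'a set" where
  "tangent_space S p = {velocity \<gamma> 0 | \<gamma>. C2_curve_at S p \<gamma>}"

(* The vector-valued quadratic form v \<mapsto> II_p(v, v) of the second fundamental form: the component
   normal to S of the acceleration of any C^2 curve in S through p with velocity v.
   On an embedded C^2 hypersurface this does not depend on the curve, so the description is
   well defined for v in the tangent space; for other v the value is unspecified. *)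
definition second_fundamental_form :: "'a::euclidean_space set \<Rightarrow> 'a \<Rightarrow> 'a \<Rightarrow> 'a" where
  "second_fundamental_form S p v =
     (THE w. \<exists>\<gamma>. C2_curve_at S p \<gamma> \<and> velocity \<gamma> 0 = v \<and>
        w \<in> orthogonal_comp (tangent_space S p) \<and>
        acceleration \<gamma> 0 - w \<in> tangent_space S p)"

definition orthonormal_basis_of :: "'a::euclidean_space set \<Rightarrow> 'a set \<Rightarrow> bool" where
  "orthonormal_basis_of T B \<longleftrightarrow>
     B \<subseteq> T \<and> pairwise orthogonal B \<and> (\<forall>b\<in>B. norm b = 1) \<and> span B = T"

(* The unnormalised trace of the second fundamental form (no factor 1 / dim S). The trace does
   not depend on the orthonormal basis, so the choice is immaterial. *)
definition mean_curvature_vector :: "'a::euclidean_space set \<Rightarrow> 'a \<Rightarrow> 'a" where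
  "mean_curvature_vector S p =
     (\<Sum>b\<in>(SOME B. orthonormal_basis_of (tangent_space S p) B). second_fundamental_form S p b)"

definition minimal_hypersurface :: "'a::euclidean_space set \<Rightarrow> bool" where
  "minimal_hypersurface S \<longleftrightarrow>
     embedded_C2_hypersurface S \<and> (\<forall>p\<in>S. mean_curvature_vector S p = 0)"

(* The sums g i + g j over unordered pairs i \<noteq> j are pairwise distinct: "sum g P" is g i + g j for
   P = {i, j}. *)
definition pair_sum_nonresonant :: "('n::finite \<Rightarrow> real) \<Rightarrow> bool" where
  "pair_sum_nonresonant g \<longleftrightarrow> inj_on (sum g) {P. card P = 2}"

(* The matrix diag(t^g_1, ..., t^g_n), acting on column vectors; used for t > 0. *)
definition weighted_dilation :: "('n::finite \<Rightarrow> real) \<Rightarrow> real \<Rightarrow> real^'n \<Rightarrow> real^'n" where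
  "weighted_dilation g t x = (\<chi> i. t powr g i * x $ i)"

end

theory Submission
  imports Defs
begin

text \<open>
  Near each of its points, a hypersurface is the zero set of a \<open>C\<^sup>2\<close> function with gradient \<open>N\<close> and
  Hessian \<open>H\<close>, and minimality at \<open>p\<close> reads \<open>\<bar>N\<bar>\<^sup>2 tr H = H N \<bullet> N\<close>. At the point \<open>D\<^sub>t p\<close> the same
  equation holds with \<open>N\<close>, \<open>H\<close> replaced by \<open>D\<^sub>t\<^sup>-\<^sup>1 N\<close>, \<open>D\<^sub>t\<^sup>-\<^sup>1 H D\<^sub>t\<^sup>-\<^sup>1\<close>. It is then a sum of terms
  \<open>t powr (-2 (g\<^sub>i + g\<^sub>j)) * Q\<^sub>i\<^sub>j\<close> over pairs \<open>{i, j}\<close>, and since the exponents are distinct every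
  \<open>Q\<^sub>i\<^sub>j\<close> vanishes. But \<open>Q\<^sub>i\<^sub>j = H w \<bullet> w\<close> for the tangent vector \<open>w = N\<^sub>j e\<^sub>i - N\<^sub>i e\<^sub>j\<close>.

  Take \<open>p\<close> at which the number of nonzero components of \<open>N\<close> is maximal, so that the components
  that are zero at \<open>p\<close> vanish near \<open>p\<close> on the hypersurface. Together with \<open>Q\<^sub>i\<^sub>j = 0\<close> this forces
  the second fundamental form to vanish at \<open>p\<close>, if at least two components of \<open>N\<close> are nonzero.
  But the field \<open>X\<^sub>i = g\<^sub>i x\<^sub>i\<close> is tangent, and differentiating \<open>N \<bullet> X = 0\<close> along \<open>w\<close> gives
  \<open>H w \<bullet> X = - (g\<^sub>i - g\<^sub>j) N\<^sub>i N\<^sub>j\<close>. Pair-sum nonresonance with \<open>n \<ge> 3\<close> makes the weights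
  distinct, so only one component of \<open>N\<close> is nonzero, say the \<open>i\<close>-th. Then \<open>N \<bullet> X = 0\<close> yields
  \<open>x\<^sub>i = 0\<close>, and \<open>i\<close> is constant by connectedness.
\<close>

section \<open>Twice differentiable maps and curves\<close>

lemma C2_on_bounded_linear_compose:
  fixes f :: "'a::real_normed_vector \<Rightarrow> 'b::real_normed_vector" and L :: "'b \<Rightarrow> 'c::real_normed_vector"
  assumes "C2_on U f" and L: "bounded_linear L"
  shows "C2_on U (\<lambda>x. L (f x))"
proof -
  obtain f' f'' where f': "\<And>x. x \<in> U \<Longrightarrow> (f has_derivative blinfun_apply (f' x)) (at x)"
    and f'': "\<And>x. x \<in> U \<Longrightarrow> (f' has_derivative blinfun_apply (f'' x)) (at x)"
    and cont: "continuous_on U f''"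
    using assms(1) unfolding C2_on_def by blast
  define B where "B = Blinfun L"
  have B: "blinfun_apply B = L" unfolding B_def by (simp add: L bounded_linear_Blinfun_apply)
  \<comment> \<open>\<open>C2_on\<close> asks for the second derivative as a bundled operator, so
    composition with \<open>B\<close> is bundled too, as an operator between spaces of
    operators.\<close>
  define C :: "('a \<Rightarrow>\<^sub>L 'b) \<Rightarrow>\<^sub>L ('a \<Rightarrow>\<^sub>L 'c)" where "C = Blinfun ((o\<^sub>L) B)"
  have bl: "bounded_linear ((o\<^sub>L) B :: ('a \<Rightarrow>\<^sub>L 'b) \<Rightarrow> ('a \<Rightarrow>\<^sub>L 'c))"
    by (rule bounded_bilinear.bounded_linear_right[OF bounded_bilinear_blinfun_compose])
  have C: "blinfun_apply C = (o\<^sub>L) B"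
    unfolding C_def using bl by (simp add: bounded_linear_Blinfun_apply)
  show ?thesis
    unfolding C2_on_def
  proof (intro exI[of _ "\<lambda>x. B o\<^sub>L f' x"] exI[of _ "\<lambda>x. C o\<^sub>L f'' x"] conjI ballI)
    fix x assume x: "x \<in> U"
    show "((\<lambda>x. L (f x)) has_derivative blinfun_apply (B o\<^sub>L f' x)) (at x)"
      using bounded_linear.has_derivative[OF L f'[OF x]] by (simp add: B o_def blinfun_compose.rep_eq)
    show "((\<lambda>x. B o\<^sub>L f' x) has_derivative blinfun_apply (C o\<^sub>L f'' x)) (at x)"
      using bounded_linear.has_derivative[OF bl f''[OF x]] by (simp add: C o_def blinfun_compose.rep_eq)
  next
    show "continuous_on U (\<lambda>x. C o\<^sub>L f'' x)"
      by (intro bounded_bilinear.continuous_on[OF bounded_bilinear_blinfun_compose] continuous_on_const cont)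
  qed
qed

text \<open>Meant for curves: with \<open>f = \<psi>\<close>, a straight segment in a chart yields a
  C^2 curve in the hypersurface.\<close>

lemma C2_on_compose_affine:
  fixes f :: "'a::real_normed_vector \<Rightarrow> 'b::real_normed_vector" and L :: "'c::real_normed_vector \<Rightarrow> 'a"
  assumes "C2_on V f" and L: "bounded_linear L" and sub: "\<And>s. s \<in> U \<Longrightarrow> a + L s \<in> V"
  shows "C2_on U (\<lambda>s. f (a + L s))"
proof -
  obtain f' f'' where f': "\<And>x. x \<in> V \<Longrightarrow> (f has_derivative blinfun_apply (f' x)) (at x)"
    and f'': "\<And>x. x \<in> V \<Longrightarrow> (f' has_derivative blinfun_apply (f'' x)) (at x)"
    and cont: "continuous_on V f''"
    using assms(1) unfolding C2_on_def by blast
  define B where "B = Blinfun L"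
  have B: "blinfun_apply B = L" unfolding B_def by (simp add: L bounded_linear_Blinfun_apply)
  define C :: "('a \<Rightarrow>\<^sub>L 'b) \<Rightarrow>\<^sub>L ('c \<Rightarrow>\<^sub>L 'b)" where "C = Blinfun (\<lambda>A. A o\<^sub>L B)"
  have bl: "bounded_linear (\<lambda>A :: 'a \<Rightarrow>\<^sub>L 'b. A o\<^sub>L B)"
    by (rule bounded_bilinear.bounded_linear_left[OF bounded_bilinear_blinfun_compose])
  have C: "blinfun_apply C = (\<lambda>A. A o\<^sub>L B)"
    unfolding C_def using bl by (simp add: bounded_linear_Blinfun_apply)
  have aff: "((\<lambda>s. a + L s) has_derivative L) (at s)" for s
    by (auto intro!: derivative_eq_intros bounded_linear_imp_has_derivative[OF L])
  show ?thesis
    unfolding C2_on_def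
  proof (intro exI[of _ "\<lambda>s. f' (a + L s) o\<^sub>L B"] exI[of _ "\<lambda>s. (C o\<^sub>L f'' (a + L s)) o\<^sub>L B"] conjI ballI)
    fix s assume s: "s \<in> U"
    show "((\<lambda>s. f (a + L s)) has_derivative blinfun_apply (f' (a + L s) o\<^sub>L B)) (at s)"
      using has_derivative_compose[OF aff f'[OF sub[OF s]]] by (simp add: B o_def blinfun_compose.rep_eq)
    show "((\<lambda>s. f' (a + L s) o\<^sub>L B) has_derivative blinfun_apply ((C o\<^sub>L f'' (a + L s)) o\<^sub>L B)) (at s)"
      using bounded_linear.has_derivative[OF bl has_derivative_compose[OF aff f''[OF sub[OF s]]]]
      by (simp add: B C o_def blinfun_compose.rep_eq)
  next
    have "continuous_on U (\<lambda>s. a + L s)"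
      by (intro continuous_intros linear_continuous_on L)
    then have "continuous_on U (\<lambda>s. f'' (a + L s))"
      by (rule continuous_on_compose2[OF cont]) (use sub in auto)
    then show "continuous_on U (\<lambda>s. (C o\<^sub>L f'' (a + L s)) o\<^sub>L B)"
      by (intro bounded_bilinear.continuous_on[OF bounded_bilinear_blinfun_compose] continuous_on_const)
  qed
qed

lemma C2_on_vector_derivativeI:
  fixes \<gamma> :: "real \<Rightarrow> 'a::real_normed_vector"
  assumes d1: "\<And>s. s \<in> U \<Longrightarrow> (\<gamma> has_vector_derivative \<gamma>' s) (at s)"
    and d2: "\<And>s. s \<in> U \<Longrightarrow> (\<gamma>' has_vector_derivative \<gamma>'' s) (at s)"
    and cont: "continuous_on U \<gamma>''"
  shows "C2_on U \<gamma>"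
  unfolding C2_on_def
\<comment> \<open>A vector \<open>x\<close> is turned into the operator
  \<open>h \<mapsto> h *\<^sub>R x\<close>; the second derivative needs this embedding
  twice.\<close>
proof (intro exI[of _ "\<lambda>s. blinfun_scaleR_left (\<gamma>' s)"]
    exI[of _ "\<lambda>s. blinfun_scaleR_left (blinfun_scaleR_left (\<gamma>'' s))"] conjI ballI)
  fix s assume s: "s \<in> U"
  show "(\<gamma> has_derivative blinfun_apply (blinfun_scaleR_left (\<gamma>' s))) (at s)"
    using d1[OF s] by (simp add: has_vector_derivative_def)
  have "((\<lambda>s. blinfun_scaleR_left (\<gamma>' s)) has_derivative (\<lambda>h. blinfun_scaleR_left (h *\<^sub>R \<gamma>'' s))) (at s)"
    using bounded_linear.has_derivative[OF bounded_linear_blinfun_scaleR_left]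
      d2[OF s] unfolding has_vector_derivative_def by blast
  moreover have "blinfun_scaleR_left (h *\<^sub>R \<gamma>'' s) = h *\<^sub>R blinfun_scaleR_left (\<gamma>'' s)" for h
    by (simp add: linear_simps bounded_linear_blinfun_scaleR_left)
  ultimately show "((\<lambda>s. blinfun_scaleR_left (\<gamma>' s)) has_derivative
      blinfun_apply (blinfun_scaleR_left (blinfun_scaleR_left (\<gamma>'' s)))) (at s)"
    by simp
next
  show "continuous_on U (\<lambda>s. blinfun_scaleR_left (blinfun_scaleR_left (\<gamma>'' s)))"
    by (intro bounded_linear.continuous_on[OF bounded_linear_blinfun_scaleR_left] cont)
qed

section \<open>Curves of class C^2 in a set\<close>

text \<open>\<open>velocity\<close> and \<open>acceleration\<close> are total functions that mean
  something only where the derivative exists; this rule supplies the existence.\<close>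

lemma C2_curve_atE:
  assumes "C2_curve_at S p \<gamma>"
  obtains \<epsilon> where "\<epsilon> > 0" "\<gamma> 0 = p" "\<And>s. \<bar>s\<bar> < \<epsilon> \<Longrightarrow> \<gamma> s \<in> S"
    "\<And>s. \<bar>s\<bar> < \<epsilon> \<Longrightarrow> (\<gamma> has_vector_derivative velocity \<gamma> s) (at s)"
    "(velocity \<gamma> has_vector_derivative acceleration \<gamma> 0) (at 0)"
proof -
  obtain \<epsilon> where e: "\<epsilon> > 0" "\<gamma> 0 = p" "\<gamma> ` {-\<epsilon><..<\<epsilon>} \<subseteq> S" and "C2_on {-\<epsilon><..<\<epsilon>} \<gamma>"
    using assms unfolding C2_curve_at_def by blast
  then obtain f' f'' where f': "\<And>x. x \<in> {-\<epsilon><..<\<epsilon>} \<Longrightarrow> (\<gamma> has_derivative blinfun_apply (f' x)) (at x)"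
    and f'': "\<And>x. x \<in> {-\<epsilon><..<\<epsilon>} \<Longrightarrow> (f' has_derivative blinfun_apply (f'' x)) (at x)"
    unfolding C2_on_def by blast
  have scale: "blinfun_apply (A :: real \<Rightarrow>\<^sub>L 'c::real_normed_vector) h = h *\<^sub>R blinfun_apply A 1" for A h
    using blinfun.scaleR_right[of A h 1] unfolding real_scaleR_def mult_1_right .
  have d1: "(\<gamma> has_vector_derivative f' s 1) (at s)" if "s \<in> {-\<epsilon><..<\<epsilon>}" for s
  proof -
    have "blinfun_apply (f' s) h = h *\<^sub>R f' s 1" for h
      by (rule scale)
    then have "blinfun_apply (f' s) = (\<lambda>h. h *\<^sub>R f' s 1)" by (rule ext)
    then show ?thesis using f'[OF that] unfolding has_vector_derivative_def by simp
  qed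
  then have v: "velocity \<gamma> s = f' s 1" if "s \<in> {-\<epsilon><..<\<epsilon>}" for s
    using that unfolding velocity_def by (simp add: vector_derivative_at)
  have 0: "0 \<in> {-\<epsilon><..<\<epsilon>}" using e by simp
  have "((\<lambda>s. f' s 1) has_derivative (\<lambda>h. f'' 0 h 1)) (at 0)"
    using bounded_linear.has_derivative[OF blinfun.bounded_linear_left f''[OF 0]] .
  moreover have "(\<lambda>h. f'' 0 h 1) = (\<lambda>h. h *\<^sub>R f'' 0 1 1)"
  proof
    show "f'' 0 h 1 = h *\<^sub>R f'' 0 1 1" for h
      unfolding scale[of "f'' 0" h] by (rule blinfun.scaleR_left)
  qed
  ultimately have "((\<lambda>s. f' s 1) has_vector_derivative f'' 0 1 1) (at 0)"
    unfolding has_vector_derivative_def by (rule has_derivative_eq_rhs)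
  then have d2: "(velocity \<gamma> has_vector_derivative f'' 0 1 1) (at 0)"
    by (rule has_vector_derivative_transform_within_open[of _ _ _ "{-\<epsilon><..<\<epsilon>}"]) (use 0 v in auto)
  show thesis
  proof (rule that[OF e(1,2)])
    show "(velocity \<gamma> has_vector_derivative acceleration \<gamma> 0) (at 0)"
      using d2 unfolding acceleration_def by (simp add: vector_derivative_at)
  qed (use e d1 v in \<open>auto simp: abs_less_iff image_subset_iff minus_less_iff\<close>)
qed

lemma C2_curve_at_linear_image:
  assumes "bounded_linear L" "C2_curve_at S p \<gamma>"
  shows "C2_curve_at (L ` S) (L p) (\<lambda>s. L (\<gamma> s))"
    and "velocity (\<lambda>s. L (\<gamma> s)) 0 = L (velocity \<gamma> 0)"
    and "acceleration (\<lambda>s. L (\<gamma> s)) 0 = L (acceleration \<gamma> 0)"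
proof -
  show "C2_curve_at (L ` S) (L p) (\<lambda>s. L (\<gamma> s))"
    using assms(2) C2_on_bounded_linear_compose[OF _ assms(1)] unfolding C2_curve_at_def by fastforce
  obtain \<epsilon> where e: "\<epsilon> > 0" "\<And>s. \<bar>s\<bar> < \<epsilon> \<Longrightarrow> (\<gamma> has_vector_derivative velocity \<gamma> s) (at s)"
    and a: "(velocity \<gamma> has_vector_derivative acceleration \<gamma> 0) (at 0)"
    using C2_curve_atE[OF assms(2)] by metis
  have v: "velocity (\<lambda>s. L (\<gamma> s)) s = L (velocity \<gamma> s)" if "\<bar>s\<bar> < \<epsilon>" for s
    using bounded_linear.has_vector_derivative[OF assms(1) e(2)[OF that]]
    by (simp add: velocity_def vector_derivative_at)
  then show "velocity (\<lambda>s. L (\<gamma> s)) 0 = L (velocity \<gamma> 0)" using e by simp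
  have "((\<lambda>s. L (velocity \<gamma> s)) has_vector_derivative L (acceleration \<gamma> 0)) (at 0)"
    using bounded_linear.has_vector_derivative[OF assms(1) a] .
  then have "(velocity (\<lambda>s. L (\<gamma> s)) has_vector_derivative L (acceleration \<gamma> 0)) (at 0)"
    by (rule has_vector_derivative_transform_within_open[of _ _ _ "{-\<epsilon><..<\<epsilon>}"]) (use e v in auto)
  then show "acceleration (\<lambda>s. L (\<gamma> s)) 0 = L (acceleration \<gamma> 0)"
    by (simp add: acceleration_def vector_derivative_at)
qed

section \<open>Symmetry of the second derivative\<close>

text \<open>With \<open>h s = f (y1 s) - f (y2 s)\<close> the second difference is
  \<open>h 1 - h 0\<close>. The mean value theorem turns it into a difference of values of
  \<open>f'\<close>, which differentiability of \<open>f'\<close> at \<open>p\<close> compares with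
  \<open>f'' (t *\<^sub>R v)\<close>.\<close>

lemma second_difference_approximation:
  fixes f :: "'a::real_normed_vector \<Rightarrow> real"
  assumes U: "open U" "p \<in> U"
    and f': "\<And>x. x \<in> U \<Longrightarrow> (f has_derivative blinfun_apply (f' x)) (at x)"
    and f'': "(f' has_derivative blinfun_apply f'') (at p)"
    and e: "e > 0"
  shows "\<forall>\<^sub>F t in at_right 0.
    \<bar>f (p + t *\<^sub>R u + t *\<^sub>R v) - f (p + t *\<^sub>R u) - f (p + t *\<^sub>R v) + f p - t\<^sup>2 * f'' v u\<bar> \<le> e * t\<^sup>2"
proof -
  \<comment> \<open>The summand 1 keeps \<open>M\<close> positive when \<open>u\<close> and
    \<open>v\<close> are both zero.\<close>
  define M where "M = norm u + norm v + 1"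
  have M: "M > 0" "norm u \<le> M" "norm v \<le> M" "norm u + norm v \<le> M" unfolding M_def by (auto simp: add_nonneg_pos)
  \<comment> \<open>Two errors of size \<open>e' * (t * M)\<close>, applied to a vector of norm at
    most \<open>t * M\<close>, add up to exactly \<open>e * t\<^sup>2\<close>.\<close>
  define e' where "e' = e / (2 * M * M)"
  have e': "e' > 0" using e M by (simp add: e'_def)
  obtain d1 where d1: "d1 > 0" "\<And>y. norm (y - p) < d1 \<Longrightarrow> norm (f' y - f' p - f'' (y - p)) \<le> e' * norm (y - p)"
    using f'' e' unfolding has_derivative_at_alt by blast
  obtain d2 where d2: "d2 > 0" "ball p d2 \<subseteq> U" using U openE by blast
  define d where "d = min d1 d2 / M"
  have d: "d > 0" using d1 d2 M by (simp add: d_def)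
  have "\<bar>f (p + t *\<^sub>R u + t *\<^sub>R v) - f (p + t *\<^sub>R u) - f (p + t *\<^sub>R v) + f p - t\<^sup>2 * f'' v u\<bar> \<le> e * t\<^sup>2"
    if t: "0 < t" "t < d" for t
  proof -
    have tM: "t * M < d1" "t * M < d2" using t M by (auto simp: d_def field_simps)
    have n1: "norm ((s * t) *\<^sub>R u + t *\<^sub>R v) \<le> t * M" "norm ((s * t) *\<^sub>R u) \<le> t * M" if s: "0 \<le> s" "s \<le> 1" for s
    proof -
      have "s * (t * norm u) \<le> 1 * (t * norm u)" using s t by (intro mult_right_mono) auto
      then have "norm ((s * t) *\<^sub>R u) \<le> t * norm u" using s t
        by (simp add: abs_mult mult.assoc)
      moreover have "norm (t *\<^sub>R v) \<le> t * norm v" using t by simp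
      ultimately have "norm ((s * t) *\<^sub>R u + t *\<^sub>R v) \<le> t * (norm u + norm v)"
        by (simp add: distrib_left norm_triangle_le)
      also have "\<dots> \<le> t * M" using M t by (intro mult_left_mono) auto
      finally show "norm ((s * t) *\<^sub>R u + t *\<^sub>R v) \<le> t * M" .
      show "norm ((s * t) *\<^sub>R u) \<le> t * M"
        using \<open>norm ((s * t) *\<^sub>R u) \<le> t * norm u\<close> mult_left_mono[OF M(2), of t] t by linarith
    qed
    define y1 y2 where "y1 s = p + ((s * t) *\<^sub>R u + t *\<^sub>R v)" and "y2 s = p + (s * t) *\<^sub>R u" for s
    have yU: "y1 s \<in> U" "y2 s \<in> U" "norm (y1 s - p) < d1" "norm (y2 s - p) < d1"
        "norm (y1 s - p) \<le> t * M" "norm (y2 s - p) \<le> t * M" if s: "0 \<le> s" "s \<le> 1" for s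
    proof -
      show "norm (y1 s - p) \<le> t * M" "norm (y2 s - p) \<le> t * M"
        using n1[OF s] by (auto simp: y1_def y2_def)
      then show "norm (y1 s - p) < d1" "norm (y2 s - p) < d1" using tM by auto
      have "dist p (y1 s) < d2" "dist p (y2 s) < d2"
        using \<open>norm (y1 s - p) \<le> t * M\<close> \<open>norm (y2 s - p) \<le> t * M\<close> tM
        by (auto simp: dist_norm norm_minus_commute)
      then show "y1 s \<in> U" "y2 s \<in> U" using d2(2) by auto
    qed
    have y': "(y1 has_derivative (\<lambda>h. (h * t) *\<^sub>R u)) (at s)" "(y2 has_derivative (\<lambda>h. (h * t) *\<^sub>R u)) (at s)" for s
      unfolding y1_def y2_def by (auto intro!: derivative_eq_intros)
    define h where "h s = f (y1 s) - f (y2 s)" for s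
    have h': "DERIV h s :> f' (y1 s) (t *\<^sub>R u) - f' (y2 s) (t *\<^sub>R u)" if s: "0 \<le> s" "s \<le> 1" for s
    proof -
      have "(h has_derivative (\<lambda>x. f' (y1 s) ((x * t) *\<^sub>R u) - f' (y2 s) ((x * t) *\<^sub>R u))) (at s)"
        unfolding h_def
        by (intro has_derivative_diff has_derivative_compose[OF y'(1) f'] has_derivative_compose[OF y'(2) f'] yU s)
      then show ?thesis unfolding has_field_derivative_def
        by (rule back_subst[of "\<lambda>x. (h has_derivative x) (at s)"])
          (auto simp: blinfun.scaleR_right algebra_simps)
    qed
    obtain z where z: "0 < z" "z < 1" "h 1 - h 0 = (1 - 0) * (f' (y1 z) (t *\<^sub>R u) - f' (y2 z) (t *\<^sub>R u))"
      using MVT2[of 0 1 h "\<lambda>s. f' (y1 s) (t *\<^sub>R u) - f' (y2 s) (t *\<^sub>R u)"] h' by auto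
    have z': "0 \<le> z" "z \<le> 1" using z by auto
    have "f' (y1 z) - f' (y2 z) - f'' (t *\<^sub>R v) =
        (f' (y1 z) - f' p - f'' (y1 z - p)) - (f' (y2 z) - f' p - f'' (y2 z - p))"
      by (simp add: y1_def y2_def blinfun.add_right)
    then have "norm (f' (y1 z) - f' (y2 z) - f'' (t *\<^sub>R v)) \<le>
        norm (f' (y1 z) - f' p - f'' (y1 z - p)) + norm (f' (y2 z) - f' p - f'' (y2 z - p))"
      using norm_triangle_ineq4 by metis
    also have "\<dots> \<le> e' * norm (y1 z - p) + e' * norm (y2 z - p)"
      by (intro add_mono d1(2) yU z')
    also have "\<dots> \<le> e' * (t * M) + e' * (t * M)"
      using e' yU[OF z'] by (intro add_mono mult_left_mono) auto
    finally have A: "norm (f' (y1 z) - f' (y2 z) - f'' (t *\<^sub>R v)) \<le> 2 * e' * t * M" by (simp add: mult_ac)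
    have "h 1 - h 0 - t\<^sup>2 * f'' v u = (f' (y1 z) - f' (y2 z) - f'' (t *\<^sub>R v)) (t *\<^sub>R u)"
      using z(3) by (simp add: blinfun.diff_left blinfun.scaleR_left blinfun.scaleR_right power2_eq_square right_diff_distrib mult.assoc)
    then have "\<bar>h 1 - h 0 - t\<^sup>2 * f'' v u\<bar> \<le> norm (f' (y1 z) - f' (y2 z) - f'' (t *\<^sub>R v)) * norm (t *\<^sub>R u)"
      using norm_blinfun real_norm_def by metis
    also have "\<dots> \<le> (2 * e' * t * M) * (t * M)"
      using A M t e' by (intro mult_mono) auto
    also have "\<dots> = e * t\<^sup>2"
      using M(1) by (simp add: e'_def field_simps power2_eq_square)
    finally show ?thesis by (simp add: h_def y1_def y2_def add.assoc algebra_simps)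
  qed
  then show ?thesis unfolding eventually_at_right_field using d by blast
qed

text \<open>The second difference is unchanged when \<open>u\<close> and \<open>v\<close> are
  swapped, so it approximates both \<open>t\<^sup>2 * f'' v u\<close> and
  \<open>t\<^sup>2 * f'' u v\<close>.\<close>

lemma second_derivative_symmetric:
  fixes f :: "'a::real_normed_vector \<Rightarrow> real"
  assumes "open U" "p \<in> U"
    and "\<And>x. x \<in> U \<Longrightarrow> (f has_derivative blinfun_apply (f' x)) (at x)"
    and "(f' has_derivative blinfun_apply f'') (at p)"
  shows "f'' u v = f'' v u"
proof (rule ccontr)
  assume ne: "f'' u v \<noteq> f'' v u"
  \<comment> \<open>The two approximations together err by at most \<open>2 * e\<close> per
    \<open>t\<^sup>2\<close>, while the assumed gap is \<open>3 * e\<close>.\<close>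
  define e where "e = \<bar>f'' u v - f'' v u\<bar> / 3"
  have e: "e > 0" using ne by (simp add: e_def)
  have D: "\<forall>\<^sub>F t in at_right 0.
    \<bar>f (p + t *\<^sub>R u + t *\<^sub>R v) - f (p + t *\<^sub>R u) - f (p + t *\<^sub>R v) + f p - t\<^sup>2 * f'' v u\<bar> \<le> e * t\<^sup>2" for u v
    by (rule second_difference_approximation[OF assms(1,2) _ assms(4) e]) (rule assms(3))
  have "\<forall>\<^sub>F t in at_right (0::real). False"
    using D[of v u] D[of u v] eventually_at_right_less[of 0]
  proof eventually_elim
    case (elim t)
    then have "\<bar>t\<^sup>2 * f'' u v - t\<^sup>2 * f'' v u\<bar> \<le> 2 * (e * t\<^sup>2)"
      by (simp add: add_ac)
    then have "t\<^sup>2 * \<bar>f'' u v - f'' v u\<bar> \<le> t\<^sup>2 * (2 * e)"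
      by (metis abs_mult abs_power2 mult.commute mult.left_commute right_diff_distrib)
    then have "\<bar>f'' u v - f'' v u\<bar> \<le> 2 * e" using elim by simp
    then show False using e unfolding e_def by simp
  qed
  then show False by simp
qed

section \<open>Gradient and Hessian of a local defining function\<close>

text \<open>Stands for \<open>n = \<nabla>F(p)\<close> and \<open>h = D\<^sup>2F(p)\<close> of a local defining function \<open>F\<close>, in a form that
  mentions neither \<open>F\<close> nor charts, hence is easy to transport by linear maps preserving \<open>S\<close>.\<close>

definition curvature_data :: "'a::euclidean_space set \<Rightarrow> 'a \<Rightarrow> 'a \<Rightarrow> ('a \<Rightarrow> 'a) \<Rightarrow> bool" where
  "curvature_data S p n h \<longleftrightarrow>
     n \<noteq> 0 \<and> linear h \<and> (\<forall>u v. h u \<bullet> v = h v \<bullet> u) \<and>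
     tangent_space S p = {v. n \<bullet> v = 0} \<and>
     (\<forall>\<gamma>. C2_curve_at S p \<gamma> \<longrightarrow> n \<bullet> acceleration \<gamma> 0 + h (velocity \<gamma> 0) \<bullet> velocity \<gamma> 0 = 0)"

text \<open>A slice chart gives the defining function \<open>F x = k \<bullet> \<phi> x\<close> with
  gradient \<open>N\<close> and Hessian \<open>H\<close>. These are fields on all of
  \<open>U\<close>, so \<open>N\<close> can be differentiated later; differentiating
  \<open>F (\<gamma> s) = 0\<close> twice gives the relation with the acceleration.\<close>

lemma embedded_C2_hypersurface_local_curvature_data:
  fixes S :: "'a::euclidean_space set"
  assumes "embedded_C2_hypersurface S" "p \<in> S"
  obtains U N H where "open U" "p \<in> U" "\<And>x. x \<in> U \<Longrightarrow> (N has_derivative H x) (at x)"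
    "\<And>q. q \<in> S \<inter> U \<Longrightarrow> curvature_data S q (N q) (H q)"
proof -
  obtain U and V :: "'a set" and \<phi> \<psi> k where k: "k \<in> Basis" and U: "open U" "p \<in> U" and V: "open V"
    and hom: "homeomorphism U V \<phi> \<psi>" and \<phi>: "C2_on U \<phi>" and \<psi>: "C2_on V \<psi>"
    and img: "\<phi> ` (S \<inter> U) = {y \<in> V. y \<bullet> k = 0}"
    using assms unfolding embedded_C2_hypersurface_def by meson
  obtain \<phi>' \<phi>'' where \<phi>': "\<And>x. x \<in> U \<Longrightarrow> (\<phi> has_derivative blinfun_apply (\<phi>' x)) (at x)"
    and \<phi>'': "\<And>x. x \<in> U \<Longrightarrow> (\<phi>' has_derivative blinfun_apply (\<phi>'' x)) (at x)"
    using \<phi> unfolding C2_on_def by blast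
  obtain \<psi>' where \<psi>': "\<And>y. y \<in> V \<Longrightarrow> (\<psi> has_derivative blinfun_apply (\<psi>' y)) (at y)"
    using \<psi> unfolding C2_on_def by blast
  have \<phi>V: "\<phi> x \<in> V" and \<psi>\<phi>: "\<psi> (\<phi> x) = x" if "x \<in> U" for x
    using hom that unfolding homeomorphism_def by auto
  have \<psi>U: "\<psi> y \<in> U" and \<phi>\<psi>: "\<phi> (\<psi> y) = y" if "y \<in> V" for y
    using hom that unfolding homeomorphism_def by auto
  have S_iff: "x \<in> S \<longleftrightarrow> \<phi> x \<bullet> k = 0" if "x \<in> U" for x
  proof
    assume "x \<in> S" then show "\<phi> x \<bullet> k = 0" using img that by blast
  next
    assume "\<phi> x \<bullet> k = 0"
    then have "\<phi> x \<in> \<phi> ` (S \<inter> U)" using img \<phi>V that by blast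
    then obtain y where "y \<in> S" "y \<in> U" "\<phi> x = \<phi> y" by blast
    then show "x \<in> S" using \<psi>\<phi> that by metis
  qed
  define F where "F x = k \<bullet> \<phi> x" for x
  define F' where "F' x = blinfun_inner_right k o\<^sub>L \<phi>' x" for x
  define F'' where "F'' x = (Blinfun (\<lambda>A. blinfun_inner_right k o\<^sub>L A) :: ('a \<Rightarrow>\<^sub>L 'a) \<Rightarrow>\<^sub>L ('a \<Rightarrow>\<^sub>L real)) o\<^sub>L \<phi>'' x" for x
  define N where "N x = (\<Sum>b\<in>Basis. F' x b *\<^sub>R b)" for x
  define H where "H x u = (\<Sum>b\<in>Basis. F'' x u b *\<^sub>R b)" for x u
  have grad: "(\<Sum>b\<in>Basis. A b *\<^sub>R b) \<bullet> v = A v" for A :: "'a \<Rightarrow>\<^sub>L real" and v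
  proof -
    have "A v = A (\<Sum>b\<in>Basis. (v \<bullet> b) *\<^sub>R b)" by (simp add: euclidean_representation)
    also have "\<dots> = (\<Sum>b\<in>Basis. (v \<bullet> b) * A b)"
      by (simp add: blinfun.sum_right blinfun.scaleR_right)
    also have "\<dots> = (\<Sum>b\<in>Basis. A b *\<^sub>R b) \<bullet> v"
      by (simp add: inner_sum_left inner_commute[of v] mult.commute)
    finally show ?thesis by simp
  qed
  have N: "N x \<bullet> v = F' x v" for x v unfolding N_def by (rule grad)
  have H: "H x u \<bullet> v = F'' x u v" for x u v unfolding H_def by (rule grad)
  have F'd: "(F has_derivative blinfun_apply (F' x)) (at x)" if "x \<in> U" for x
    unfolding F_def F'_def using bounded_linear.has_derivative[OF bounded_linear_inner_right \<phi>'[OF that], of k]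
    by (simp add: o_def blinfun_compose.rep_eq)
  have bl: "bounded_linear (\<lambda>A :: 'a \<Rightarrow>\<^sub>L 'a. blinfun_inner_right k o\<^sub>L A)"
    by (rule bounded_bilinear.bounded_linear_right[OF bounded_bilinear_blinfun_compose])
  have F''d: "(F' has_derivative blinfun_apply (F'' x)) (at x)" if "x \<in> U" for x
    unfolding F'_def F''_def using bounded_linear.has_derivative[OF bl \<phi>''[OF that]]
    by (simp add: o_def blinfun_compose.rep_eq bounded_linear_Blinfun_apply[OF bl])
  have Nd: "(N has_derivative H x) (at x)" if "x \<in> U" for x
    unfolding N_def H_def
    by (intro has_derivative_sum bounded_linear.has_derivative[OF bounded_linear_scaleR_left]
        bounded_linear.has_derivative[OF blinfun.bounded_linear_left] F''d that)
  have F0: "q \<in> S \<longleftrightarrow> F q = 0" if "q \<in> U" for q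
    using S_iff[OF that] by (simp add: F_def inner_commute)
  show thesis
  proof (rule that[OF U Nd])
    fix q assume "q \<in> S \<inter> U"
    then have q: "q \<in> S" "q \<in> U" by auto
    \<comment> \<open>Chain rule for the two compositions of \<open>\<phi>\<close> and
      \<open>\<psi>\<close>, both the identity on open sets: the derivatives are mutually
      inverse.\<close>
    have inv: "\<phi>' q (\<psi>' (\<phi> q) v) = v" "\<psi>' (\<phi> q) (\<phi>' q v) = v" for v
    proof -
      have "((\<lambda>y. \<phi> (\<psi> y)) has_derivative (\<lambda>v. \<phi>' q (\<psi>' (\<phi> q) v))) (at (\<phi> q))"
        using has_derivative_compose[OF \<psi>'[OF \<phi>V[OF q(2)]], of \<phi> "\<phi>' q"] \<phi>'[OF q(2)] \<psi>\<phi>[OF q(2)] by simp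
      then have "((\<lambda>y. y) has_derivative (\<lambda>v. \<phi>' q (\<psi>' (\<phi> q) v))) (at (\<phi> q))"
        by (rule has_derivative_transform_within_open[OF _ V \<phi>V[OF q(2)]]) (use \<phi>\<psi> in auto)
      then show "\<phi>' q (\<psi>' (\<phi> q) v) = v"
        using has_derivative_unique[OF has_derivative_ident] by metis
      have "((\<lambda>x. \<psi> (\<phi> x)) has_derivative (\<lambda>v. \<psi>' (\<phi> q) (\<phi>' q v))) (at q)"
        by (rule has_derivative_compose[OF \<phi>'[OF q(2)] \<psi>'[OF \<phi>V[OF q(2)]]])
      then have "((\<lambda>x. x) has_derivative (\<lambda>v. \<psi>' (\<phi> q) (\<phi>' q v))) (at q)"
        by (rule has_derivative_transform_within_open[OF _ U(1) q(2)]) (use \<psi>\<phi> in auto)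
      then show "\<psi>' (\<phi> q) (\<phi>' q v) = v"
        using has_derivative_unique[OF has_derivative_ident] by metis
    qed
    have "N q \<noteq> 0"
    proof
      assume "N q = 0"
      \<comment> \<open>In the direction that the chart carries to \<open>k\<close>, the derivative
        of \<open>F\<close> is \<open>k \<bullet> k = 1\<close>, so the gradient cannot
        vanish.\<close>
      then have "F' q (\<psi>' (\<phi> q) k) = 0" using N[of q] by simp
      then show False using k by (simp add: F'_def inv)
    qed
    moreover have "linear (H q)" using has_derivative_linear[OF Nd[OF q(2)]] .
    moreover have "H q u \<bullet> v = H q v \<bullet> u" for u v
      unfolding H by (rule second_derivative_symmetric[OF U(1) q(2) _ F''d[OF q(2)]]) (rule F'd)
    moreover have curve: "N q \<bullet> velocity \<gamma> 0 = 0 \<and>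
        N q \<bullet> acceleration \<gamma> 0 + H q (velocity \<gamma> 0) \<bullet> velocity \<gamma> 0 = 0" if \<gamma>: "C2_curve_at S q \<gamma>" for \<gamma>
    proof -
      obtain \<epsilon> where e: "\<epsilon> > 0" "\<gamma> 0 = q" "\<And>s. \<bar>s\<bar> < \<epsilon> \<Longrightarrow> \<gamma> s \<in> S"
        "\<And>s. \<bar>s\<bar> < \<epsilon> \<Longrightarrow> (\<gamma> has_vector_derivative velocity \<gamma> s) (at s)"
        "(velocity \<gamma> has_vector_derivative acceleration \<gamma> 0) (at 0)"
        using C2_curve_atE[OF \<gamma>] by metis
      have "continuous (at 0) \<gamma>" using e by (intro has_vector_derivative_continuous[of \<gamma> "velocity \<gamma> 0"]) auto
      then have "\<forall>\<^sub>F s in at 0. \<gamma> s \<in> U"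
        using U(1) q(2) e(2) unfolding continuous_at by (simp add: topological_tendstoD)
      then obtain d where d: "d > 0" "\<And>s. s \<noteq> 0 \<Longrightarrow> dist s 0 < d \<Longrightarrow> \<gamma> s \<in> U"
        unfolding eventually_at by auto
      \<comment> \<open>On \<open>I\<close> the curve stays in both \<open>S\<close> and
        \<open>U\<close>, so \<open>F\<close> is differentiable and zero along it.\<close>
      define I where "I = {- min d \<epsilon> <..< min d \<epsilon>}"
      have I: "open I" "0 \<in> I" "\<And>s. s \<in> I \<Longrightarrow> \<bar>s\<bar> < \<epsilon>" using d e by (auto simp: I_def)
      have IU: "\<gamma> s \<in> U" if "s \<in> I" for s
        using d(2)[of s] that q e(2) by (cases "s = 0") (auto simp: I_def)
      have 1: "N (\<gamma> s) \<bullet> velocity \<gamma> s = 0" if s: "s \<in> I" for s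
      proof -
        have "((\<lambda>s. F (\<gamma> s)) has_derivative (\<lambda>h. F' (\<gamma> s) (h *\<^sub>R velocity \<gamma> s))) (at s)"
          using has_derivative_compose[OF e(4)[OF I(3)[OF s], unfolded has_vector_derivative_def] F'd[OF IU[OF s]]] .
        then have "((\<lambda>s. 0) has_derivative (\<lambda>h. F' (\<gamma> s) (h *\<^sub>R velocity \<gamma> s))) (at s)"
          by (rule has_derivative_transform_within_open[OF _ I(1) s]) (use F0 IU I e(3) in auto)
        then have "(\<lambda>h. F' (\<gamma> s) (h *\<^sub>R velocity \<gamma> s)) = (\<lambda>h. 0)"
          using has_derivative_unique[OF has_derivative_const] by metis
        from fun_cong[OF this, of 1] show ?thesis by (simp add: N)
      qed
      have "((\<lambda>s. N (\<gamma> s)) has_derivative (\<lambda>h. H q (h *\<^sub>R velocity \<gamma> 0))) (at 0)"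
        using has_derivative_compose[OF e(4)[OF I(3)[OF I(2)], unfolded has_vector_derivative_def] Nd[OF IU[OF I(2)]]]
        by (simp add: e(2))
      then have "((\<lambda>s. N (\<gamma> s) \<bullet> velocity \<gamma> s) has_derivative
          (\<lambda>h. N (\<gamma> 0) \<bullet> (h *\<^sub>R acceleration \<gamma> 0) + H q (h *\<^sub>R velocity \<gamma> 0) \<bullet> velocity \<gamma> 0)) (at 0)"
        using e(5) unfolding has_vector_derivative_def by (rule has_derivative_inner)
      then have "((\<lambda>s. 0) has_derivative
          (\<lambda>h. N (\<gamma> 0) \<bullet> (h *\<^sub>R acceleration \<gamma> 0) + H q (h *\<^sub>R velocity \<gamma> 0) \<bullet> velocity \<gamma> 0)) (at 0)"
        by (rule has_derivative_transform_within_open[OF _ I(1,2)]) (use 1 in auto)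
      then have "(\<lambda>h. N (\<gamma> 0) \<bullet> (h *\<^sub>R acceleration \<gamma> 0) + H q (h *\<^sub>R velocity \<gamma> 0) \<bullet> velocity \<gamma> 0) = (\<lambda>h. 0)"
        using has_derivative_unique[OF has_derivative_const] by metis
      from fun_cong[OF this, of 1] show ?thesis using 1[OF I(2)] by (simp add: e(2))
    qed
    moreover have "tangent_space S q = {v. N q \<bullet> v = 0}"
    proof (intro equalityI subsetI)
      fix v assume "v \<in> tangent_space S q"
      then show "v \<in> {v. N q \<bullet> v = 0}" using curve unfolding tangent_space_def by blast
    next
      fix v assume "v \<in> {v. N q \<bullet> v = 0}"
      then have v: "k \<bullet> \<phi>' q v = 0" using N[of q v] by (simp add: F'_def)
      \<comment> \<open>A tangent vector is realized by pulling back the line in direction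
        \<open>w\<close> from the chart; \<open>k \<bullet> w = 0\<close> keeps that line inside the
        slice.\<close>
      define w where "w = \<phi>' q v"
      define \<gamma> where "\<gamma> s = \<psi> (\<phi> q + s *\<^sub>R w)" for s
      have "continuous (at 0) (\<lambda>s. \<phi> q + s *\<^sub>R w)" by (intro continuous_intros)
      then have "\<forall>\<^sub>F s in at 0. \<phi> q + s *\<^sub>R w \<in> V"
        using V \<phi>V[OF q(2)] unfolding continuous_at by (simp add: topological_tendstoD)
      then obtain d where d: "d > 0" "\<And>s. s \<noteq> 0 \<Longrightarrow> dist s 0 < d \<Longrightarrow> \<phi> q + s *\<^sub>R w \<in> V"
        unfolding eventually_at by auto
      have inV: "\<phi> q + s *\<^sub>R w \<in> V" if "s \<in> {-d<..<d}" for s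
        using d(2)[of s] that \<phi>V[OF q(2)] by (cases "s = 0") auto
      have "k \<bullet> (\<phi> q + s *\<^sub>R w) = 0" for s
        using F0[OF q(2)] q(1) v by (simp add: F_def w_def inner_add_right)
      then have inS: "\<gamma> s \<in> S" if "s \<in> {-d<..<d}" for s
        using F0[OF \<psi>U[OF inV[OF that]]] \<phi>\<psi>[OF inV[OF that]] unfolding \<gamma>_def F_def by simp
      have "C2_on {-d<..<d} \<gamma>" unfolding \<gamma>_def
        by (rule C2_on_compose_affine[OF \<psi> bounded_linear_scaleR_left inV])
      then have "C2_curve_at S q \<gamma>"
        unfolding C2_curve_at_def using d inS \<psi>\<phi>[OF q(2)] by (auto simp: \<gamma>_def intro!: exI[of _ d])
      moreover have "velocity \<gamma> 0 = v"
      proof -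
        have "((\<lambda>s. \<phi> q + s *\<^sub>R w) has_derivative (\<lambda>s. s *\<^sub>R w)) (at 0)"
          by (auto intro!: derivative_eq_intros)
        then have "(\<gamma> has_derivative (\<lambda>h. \<psi>' (\<phi> q) (h *\<^sub>R w))) (at 0)"
          unfolding \<gamma>_def by (rule has_derivative_compose) (use \<psi>' \<phi>V q in simp)
        then have "(\<gamma> has_vector_derivative \<psi>' (\<phi> q) w) (at 0)"
          by (simp add: has_vector_derivative_def blinfun.scaleR_right)
        then show ?thesis unfolding velocity_def w_def by (simp add: vector_derivative_at inv)
      qed
      ultimately show "v \<in> tangent_space S q" unfolding tangent_space_def by blast
    qed
    ultimately show "curvature_data S q (N q) (H q)"
      unfolding curvature_data_def by blast
  qed
qed

section \<open>The mean curvature equation\<close>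

text \<open>The normal line is spanned by \<open>n\<close>, and
  \<open>n \<bullet> acceleration \<gamma> 0\<close> is fixed by the velocity alone. Hence all
  curves with velocity \<open>v\<close> share one normal component, which makes the definite
  description meaningful.\<close>

lemma curvature_data_second_fundamental_form:
  assumes data: "curvature_data S p n h" and v: "v \<in> tangent_space S p"
  shows "second_fundamental_form S p v = - (h v \<bullet> v / (n \<bullet> n)) *\<^sub>R n"
  unfolding second_fundamental_form_def
proof (rule the_equality)
  have n: "n \<bullet> n \<noteq> 0" and T: "tangent_space S p = {v. n \<bullet> v = 0}"
    and acc: "\<And>\<gamma>. C2_curve_at S p \<gamma> \<Longrightarrow> n \<bullet> acceleration \<gamma> 0 = - (h (velocity \<gamma> 0) \<bullet> velocity \<gamma> 0)"
    using data unfolding curvature_data_def by (simp, simp, metis add_eq_0_iff2)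
  obtain \<gamma> where \<gamma>: "C2_curve_at S p \<gamma>" "velocity \<gamma> 0 = v"
    using v unfolding tangent_space_def by blast
  have "n \<bullet> (acceleration \<gamma> 0 - (- (h v \<bullet> v / (n \<bullet> n)) *\<^sub>R n)) = 0"
    using n acc[OF \<gamma>(1)] \<gamma>(2) by (simp add: inner_diff_right inner_add_right)
  then show "\<exists>\<gamma>. C2_curve_at S p \<gamma> \<and> velocity \<gamma> 0 = v \<and>
      - (h v \<bullet> v / (n \<bullet> n)) *\<^sub>R n \<in> (tangent_space S p)\<^sup>\<bottom> \<and>
      acceleration \<gamma> 0 - - (h v \<bullet> v / (n \<bullet> n)) *\<^sub>R n \<in> tangent_space S p"
    using \<gamma> by (intro exI[of _ \<gamma>])
      (auto simp: T orthogonal_comp_def orthogonal_def inner_commute)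
  fix w
  assume "\<exists>\<gamma>. C2_curve_at S p \<gamma> \<and> velocity \<gamma> 0 = v \<and>
      w \<in> (tangent_space S p)\<^sup>\<bottom> \<and> acceleration \<gamma> 0 - w \<in> tangent_space S p"
  then obtain \<delta> where \<delta>: "C2_curve_at S p \<delta>" "velocity \<delta> 0 = v"
    and w: "\<And>y. n \<bullet> y = 0 \<Longrightarrow> w \<bullet> y = 0" and a: "n \<bullet> (acceleration \<delta> 0 - w) = 0"
    by (auto simp: T orthogonal_comp_def orthogonal_def inner_commute)
  have nw: "n \<bullet> w = - (h v \<bullet> v)" using a acc[OF \<delta>(1)] \<delta>(2) by (simp add: inner_diff_right)
  \<comment> \<open>The part of \<open>w\<close> orthogonal to \<open>n\<close> is itself tangent,
    while \<open>w\<close> is orthogonal to all tangent vectors; so this part is zero.\<close>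
  define d where "d = w - (n \<bullet> w / (n \<bullet> n)) *\<^sub>R n"
  have nd: "n \<bullet> d = 0" using n by (simp add: d_def inner_diff_right)
  have "d \<bullet> d = w \<bullet> d - (n \<bullet> w / (n \<bullet> n)) * (n \<bullet> d)"
    by (subst (1) d_def) (simp only: inner_diff_left inner_scaleR_left)
  then have "d \<bullet> d = 0" using w[OF nd] nd by simp
  then show "w = - (h v \<bullet> v / (n \<bullet> n)) *\<^sub>R n"
    by (simp add: d_def nw eq_neg_iff_add_eq_0)
qed

lemma trace_orthonormal_basis:
  fixes h :: "'a::euclidean_space \<Rightarrow> 'a"
  assumes "linear h" and C: "finite C" "pairwise orthogonal C" "\<And>c. c \<in> C \<Longrightarrow> norm c = 1" "span C = UNIV"
  shows "(\<Sum>c\<in>C. h c \<bullet> c) = (\<Sum>i\<in>Basis. h i \<bullet> i)"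
proof -
  interpret linear h by fact
  have ex: "(\<Sum>c\<in>C. (x \<bullet> c) *\<^sub>R c) = x" for x
    by (rule orthonormal_basis_expand) (use C in auto)
  have "(\<Sum>i\<in>Basis. h i \<bullet> i) = (\<Sum>i\<in>Basis. h i \<bullet> (\<Sum>c\<in>C. (i \<bullet> c) *\<^sub>R c))"
    by (simp add: ex)
  also have "\<dots> = (\<Sum>i\<in>Basis. \<Sum>c\<in>C. h ((c \<bullet> i) *\<^sub>R i) \<bullet> c)"
    by (simp add: inner_sum_right scaleR inner_commute)
  also have "\<dots> = (\<Sum>c\<in>C. \<Sum>i\<in>Basis. h ((c \<bullet> i) *\<^sub>R i) \<bullet> c)"
    by (rule sum.swap)
  also have "\<dots> = (\<Sum>c\<in>C. h (\<Sum>i\<in>Basis. (c \<bullet> i) *\<^sub>R i) \<bullet> c)"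
    by (simp only: sum inner_sum_left)
  also have "\<dots> = (\<Sum>c\<in>C. h c \<bullet> c)" by (simp add: euclidean_representation)
  finally show ?thesis by simp
qed

text \<open>An orthonormal basis of the tangent space and the unit normal together form one of the
  whole space. The full trace of \<open>h\<close> is thus the tangential trace, which minimality
  makes zero, plus the value on the unit normal.\<close>

lemma curvature_data_minimal:
  assumes data: "curvature_data S p n h" and "mean_curvature_vector S p = 0"
  shows "(n \<bullet> n) * (\<Sum>i\<in>Basis. h i \<bullet> i) = h n \<bullet> n"
proof -
  have n: "n \<noteq> 0" and lin: "linear h" and T: "tangent_space S p = {v. n \<bullet> v = 0}"
    using data unfolding curvature_data_def by auto
  interpret linear h by fact
  \<comment> \<open>This is the very basis chosen inside
    \<open>mean_curvature_vector\<close>.\<close>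
  define B where "B = (SOME B. orthonormal_basis_of (tangent_space S p) B)"
  have "\<exists>B. orthonormal_basis_of (tangent_space S p) B"
    unfolding orthonormal_basis_of_def T by (rule orthonormal_basis_subspace[OF subspace_hyperplane[of n]]) blast
  then have "orthonormal_basis_of (tangent_space S p) B"
    unfolding B_def by (rule someI_ex)
  then have BT: "B \<subseteq> {v. n \<bullet> v = 0}" and orth: "pairwise orthogonal B"
    and norm: "\<And>b. b \<in> B \<Longrightarrow> norm b = 1" and span: "span B = {v. n \<bullet> v = 0}"
    unfolding orthonormal_basis_of_def T by auto
  have fin: "finite B" by (rule pairwise_orthogonal_imp_finite[OF orth])
  have "0 = (\<Sum>b\<in>B. second_fundamental_form S p b)"
    using assms(2) unfolding mean_curvature_vector_def B_def[symmetric] by simp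
  also have "\<dots> = (\<Sum>b\<in>B. - (h b \<bullet> b / (n \<bullet> n)) *\<^sub>R n)"
    using BT by (intro sum.cong curvature_data_second_fundamental_form[OF data]) (auto simp: T)
  also have "\<dots> = - ((\<Sum>b\<in>B. h b \<bullet> b) / (n \<bullet> n)) *\<^sub>R n"
    by (simp add: sum_negf scaleR_left.sum sum_divide_distrib)
  finally have B0: "(\<Sum>b\<in>B. h b \<bullet> b) = 0" using n by simp
  define \<nu> where "\<nu> = (1 / norm n) *\<^sub>R n"
  have \<nu>: "norm \<nu> = 1" "\<And>b. b \<in> B \<Longrightarrow> \<nu> \<bullet> b = 0" using n BT by (auto simp: \<nu>_def)
  then have "\<nu> \<notin> B" by force
  have "(\<Sum>c\<in>insert \<nu> B. h c \<bullet> c) = (\<Sum>i\<in>Basis. h i \<bullet> i)"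
  proof (rule trace_orthonormal_basis[OF lin])
    show "pairwise orthogonal (insert \<nu> B)"
      using \<nu>(2) orth by (auto simp: pairwise_insert orthogonal_def inner_commute)
    have "x \<in> span (insert \<nu> B)" for x
    proof -
      have "n \<bullet> (x - (x \<bullet> \<nu>) *\<^sub>R \<nu>) = 0"
        using n by (simp add: \<nu>_def inner_diff_right inner_commute field_simps power2_norm_eq_inner[symmetric] power2_eq_square)
      then have "x - (x \<bullet> \<nu>) *\<^sub>R \<nu> \<in> span B" using span by blast
      then show ?thesis unfolding span_insert by blast
    qed
    then show "span (insert \<nu> B) = UNIV" by blast
  qed (use fin norm \<nu> in auto)
  then have "(\<Sum>i\<in>Basis. h i \<bullet> i) = h \<nu> \<bullet> \<nu>" using fin \<open>\<nu> \<notin> B\<close> B0 by simp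
  also have "\<dots> = (h n \<bullet> n) / (norm n)\<^sup>2" by (simp add: \<nu>_def scaleR power2_eq_square)
  finally show ?thesis using n by (simp add: power2_norm_eq_inner)
qed

section \<open>Transport by linear symmetries of the hypersurface\<close>

lemma tangent_space_linear_image:
  assumes "bounded_linear L" "v \<in> tangent_space S p"
  shows "L v \<in> tangent_space (L ` S) (L p)"
proof -
  obtain \<gamma> where "C2_curve_at S p \<gamma>" "velocity \<gamma> 0 = v"
    using assms(2) unfolding tangent_space_def by blast
  then show ?thesis
    unfolding tangent_space_def using C2_curve_at_linear_image(1,2)[OF assms(1), of S p \<gamma>]
    by (intro CollectI exI[of _ "\<lambda>s. L (\<gamma> s)"]) simp
qed

text \<open>Composing a defining function near \<open>p\<close> with \<open>E\<close>, the inverse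
  of \<open>D\<close>, gives one near \<open>D p\<close>, since \<open>D\<close> maps
  \<open>S\<close> onto itself. As \<open>E\<close> is self-adjoint, its gradient is
  \<open>E n\<close> and its Hessian sends \<open>v\<close> to \<open>E (h (E v))\<close>.\<close>

lemma curvature_data_linear_image:
  assumes data: "curvature_data S p n h"
    and D: "bounded_linear D" and E: "bounded_linear E" and DE: "\<And>x. D (E x) = x" "\<And>x. E (D x) = x"
    and adj: "\<And>x y. E x \<bullet> y = x \<bullet> E y" and img: "D ` S = S"
  shows "curvature_data S (D p) (E n) (\<lambda>v. E (h (E v)))"
proof -
  have h: "n \<noteq> 0" "linear h" "\<And>u v. h u \<bullet> v = h v \<bullet> u" and T: "tangent_space S p = {v. n \<bullet> v = 0}"
    and acc: "\<And>\<gamma>. C2_curve_at S p \<gamma> \<Longrightarrow> n \<bullet> acceleration \<gamma> 0 + h (velocity \<gamma> 0) \<bullet> velocity \<gamma> 0 = 0"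
    using data unfolding curvature_data_def by auto
  have img': "E ` S = S" using img DE(2) by (metis (no_types, lifting) image_image image_ident image_cong)
  have "E n \<noteq> 0" using h(1) DE(1)[of n] linear_0[OF bounded_linear.linear[OF D]] by metis
  moreover have "linear (\<lambda>v. E (h (E v)))"
    using linear_compose[OF linear_compose[OF bounded_linear.linear[OF E] h(2)] bounded_linear.linear[OF E]]
    by (simp add: o_def)
  moreover have "E (h (E u)) \<bullet> v = E (h (E v)) \<bullet> u" for u v
    by (simp add: adj h(3))
  moreover have "tangent_space S (D p) = {v. E n \<bullet> v = 0}"
  proof -
    have "v \<in> tangent_space S (D p) \<longleftrightarrow> E v \<in> tangent_space S p" for v
      using tangent_space_linear_image[OF D, of "E v" S p] tangent_space_linear_image[OF E, of v S "D p"]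
      by (auto simp: img img' DE)
    then show ?thesis by (auto simp: T adj)
  qed
  moreover have "E n \<bullet> acceleration \<gamma> 0 + E (h (E (velocity \<gamma> 0))) \<bullet> velocity \<gamma> 0 = 0"
    if \<gamma>: "C2_curve_at S (D p) \<gamma>" for \<gamma>
    using acc[of "\<lambda>s. E (\<gamma> s)"] C2_curve_at_linear_image[OF E \<gamma>] by (simp add: img' DE adj)
  ultimately show ?thesis unfolding curvature_data_def by blast
qed

section \<open>Linear independence of powers with distinct exponents\<close>

lemma powr_sum_coefficients_eq_0:
  fixes c q :: "'a \<Rightarrow> real"
  assumes "finite A" "inj_on c A" "\<And>t. t > 0 \<Longrightarrow> (\<Sum>a\<in>A. q a * t powr c a) = 0" "a \<in> A"
  shows "q a = 0"
  using assms
proof (induction A arbitrary: q a rule: finite_induct)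
  case empty
  then show ?case by simp
next
  case (insert b A)
  have "q a = 0" if "a \<in> A" for a
  proof -
    \<comment> \<open>For the sum \<open>f\<close>, the combination \<open>f (2 * t) - 2 powr c b * f t\<close> has no term with exponent \<open>c b\<close>.\<close>
    have "q a * (2 powr c a - 2 powr c b) = 0"
    proof (rule insert.IH[OF _ _ that])
      show "inj_on c A" using insert.prems by auto
      fix t :: real assume t: "t > 0"
      have "0 = (\<Sum>a\<in>insert b A. q a * (2 * t) powr c a) - 2 powr c b * (\<Sum>a\<in>insert b A. q a * t powr c a)"
        using insert.prems(2)[of t] insert.prems(2)[of "2 * t"] t by simp
      also have "\<dots> = (\<Sum>a\<in>insert b A. q a * (2 powr c a - 2 powr c b) * t powr c a)"
        using t by (simp add: sum_distrib_left sum_subtractf[symmetric] powr_mult algebra_simps del: sum.insert)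
      also have "\<dots> = (\<Sum>a\<in>A. q a * (2 powr c a - 2 powr c b) * t powr c a)"
        using insert.hyps by simp
      finally show "(\<Sum>a\<in>A. q a * (2 powr c a - 2 powr c b) * t powr c a) = 0" by simp
    qed
    moreover have "c a \<noteq> c b" using insert.prems(1) insert.hyps that by (metis insert_iff inj_on_def)
    ultimately show ?thesis by (simp add: powr_inj)
  qed
  \<comment> \<open>With all other coefficients zero, \<open>t = 1\<close> leaves \<open>q b\<close>
    alone.\<close>
  moreover have "q b = 0"
    using insert.prems(2)[of 1] insert.hyps calculation by simp
  ultimately show ?case using insert.prems by auto
qed

section \<open>Weighted dilations\<close>

lemma sum_Basis_vec:
  fixes f :: "real^'n::finite \<Rightarrow> 'b::comm_monoid_add"
  shows "(\<Sum>b\<in>Basis. f b) = (\<Sum>i\<in>UNIV. f (axis i 1))"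
proof -
  have "(Basis :: (real^'n) set) = range (\<lambda>i. axis i 1)" by (auto simp: Basis_vec_def)
  moreover have "inj (\<lambda>i :: 'n. axis i (1::real))" by (auto simp: inj_on_def axis_eq_axis)
  ultimately show ?thesis using sum.reindex[of "\<lambda>i :: 'n. axis i 1" UNIV f] by (simp only: o_def)
qed

lemma linear_inner_vec_expansion:
  fixes h :: "real^'n::finite \<Rightarrow> real^'n"
  assumes "linear h"
  shows "h u \<bullet> v = (\<Sum>i\<in>UNIV. \<Sum>j\<in>UNIV. u $ i * v $ j * (h (axis i 1) \<bullet> axis j 1))"
proof -
  interpret linear h by fact
  have "h u \<bullet> v = h (\<Sum>i\<in>UNIV. u $ i *\<^sub>R axis i 1) \<bullet> (\<Sum>j\<in>UNIV. v $ j *\<^sub>R axis j 1)"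
    using basis_expansion[of u] basis_expansion[of v] by (simp add: scalar_mult_eq_scaleR)
  also have "\<dots> = (\<Sum>i\<in>UNIV. \<Sum>j\<in>UNIV. u $ i * v $ j * (h (axis i 1) \<bullet> axis j 1))"
    by (subst sum.swap) (simp add: sum scaleR inner_sum_left inner_sum_right sum_distrib_left mult_ac)
  finally show ?thesis .
qed

lemma weighted_dilation_bounded_linear: "bounded_linear (weighted_dilation g t)"
  unfolding weighted_dilation_def
  by (intro linear_conv_bounded_linear[THEN iffD1] linearI) (auto simp: vec_eq_iff algebra_simps)

text \<open>Negating the weights inverts the dilation at the same \<open>t\<close>, so the inverse
  is again linear and self-adjoint by the lemmas on dilations.\<close>

lemma weighted_dilation_inverse:
  assumes "t > 0"
  shows "weighted_dilation g t (weighted_dilation (\<lambda>i. - g i) t x) = x"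
    and "weighted_dilation (\<lambda>i. - g i) t (weighted_dilation g t x) = x"
  using assms by (auto simp: weighted_dilation_def vec_eq_iff powr_add[symmetric] mult.assoc[symmetric])

lemma weighted_dilation_adjoint: "weighted_dilation g t x \<bullet> y = x \<bullet> weighted_dilation g t y"
  by (simp add: weighted_dilation_def inner_vec_def mult_ac)

lemma weighted_dilation_axis: "weighted_dilation g t (axis i 1) = (t powr g i) *\<^sub>R axis i 1"
  by (simp add: weighted_dilation_def vec_eq_iff axis_def)

text \<open>Orthogonal to \<open>n\<close>, hence tangent when \<open>n\<close> is a normal, and
  supported on two coordinates only.\<close>

definition tangent_pair :: "real^'n \<Rightarrow> 'n \<Rightarrow> 'n \<Rightarrow> real^'n" where
  "tangent_pair n i j = n $ j *\<^sub>R axis i 1 - n $ i *\<^sub>R axis j 1"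

text \<open>Minimality along the whole orbit of \<open>p\<close>, pulled back to \<open>p\<close>,
  is an identity in \<open>t\<close>. Its exponents are the pair sums times -2, which nonresonance
  keeps apart, so each coefficient vanishes separately.\<close>

lemma tangent_pair_null:
  fixes S :: "(real^'n::finite) set"
  assumes data: "curvature_data S p n h" and "p \<in> S" and nonres: "pair_sum_nonresonant g"
    and inv: "\<And>t. t > 0 \<Longrightarrow> weighted_dilation g t ` S = S"
    and mc: "\<And>q. q \<in> S \<Longrightarrow> mean_curvature_vector S q = 0" and "a \<noteq> b"
  shows "h (tangent_pair n a b) \<bullet> tangent_pair n a b = 0"
proof -
  have lin: "linear h" using data unfolding curvature_data_def by blast
  interpret linear h by fact
  define K where "K = {(i::'n, j). i \<noteq> j}"
  define H where "H i j = h (axis i 1) \<bullet> axis j 1" for i j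
  \<comment> \<open>The share of the ordered pair \<open>(i, j)\<close> in the difference of the two
    sides of the minimality equation; the two orders of a pair add up to the value of
    \<open>h\<close> on the tangent pair.\<close>
  define r where "r x = (case x of (i, j) \<Rightarrow> (n $ j)\<^sup>2 * H i i - n $ i * n $ j * H i j)" for x
  define q where "q P = (\<Sum>x\<in>{x \<in> K. {fst x, snd x} = P}. r x)" for P
  have "q {a, b} = 0"
  proof (rule powr_sum_coefficients_eq_0[where c = "\<lambda>P. - 2 * sum g P" and A = "{P. card P = 2}"])
    show "inj_on (\<lambda>P. - 2 * sum g P) {P. card P = 2}"
      using nonres unfolding pair_sum_nonresonant_def inj_on_def by simp
    show "{a, b} \<in> {P. card P = 2}" using \<open>a \<noteq> b\<close> by simp
    fix t :: real assume t: "t > 0"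
    define E where "E = weighted_dilation (\<lambda>i. - g i) t"
    have "curvature_data S (weighted_dilation g t p) (E n) (\<lambda>v. E (h (E v)))"
      unfolding E_def using t
      by (intro curvature_data_linear_image[OF data] weighted_dilation_bounded_linear
          weighted_dilation_inverse weighted_dilation_adjoint inv)
    moreover have "weighted_dilation g t p \<in> S" using inv[OF t] \<open>p \<in> S\<close> by blast
    ultimately have eq: "(E n \<bullet> E n) * (\<Sum>i\<in>Basis. E (h (E i)) \<bullet> i) = E (h (E (E n))) \<bullet> E n"
      by (rule curvature_data_minimal[OF _ mc])
    define s where "s i = t powr (- g i)" for i
    have Eadj: "E x \<bullet> y = x \<bullet> E y" for x y by (simp add: E_def weighted_dilation_adjoint)
    have Eax: "E (axis i 1) = s i *\<^sub>R axis i 1" for i by (simp add: E_def s_def weighted_dilation_axis)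
    have Ei: "E x $ i = s i * x $ i" for x i by (simp add: E_def s_def weighted_dilation_def)
    have "E n \<bullet> E n = (\<Sum>j\<in>UNIV. (s j)\<^sup>2 * (n $ j)\<^sup>2)"
      by (simp add: inner_vec_def Ei power2_eq_square mult_ac)
    moreover have "(\<Sum>i\<in>Basis. E (h (E i)) \<bullet> i) = (\<Sum>i\<in>UNIV. (s i)\<^sup>2 * H i i)"
      by (simp add: sum_Basis_vec Eadj Eax scaleR H_def power2_eq_square mult_ac)
    moreover have "E (h (E (E n))) \<bullet> E n = (\<Sum>i\<in>UNIV. \<Sum>j\<in>UNIV. (s i * s j)\<^sup>2 * (n $ i * n $ j * H i j))"
      unfolding Eadj by (subst linear_inner_vec_expansion[OF lin])
        (simp add: Ei H_def power2_eq_square mult_ac)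
    ultimately have "0 = (\<Sum>i\<in>UNIV. (s i)\<^sup>2 * H i i) * (\<Sum>j\<in>UNIV. (s j)\<^sup>2 * (n $ j)\<^sup>2) -
        (\<Sum>i\<in>UNIV. \<Sum>j\<in>UNIV. (s i * s j)\<^sup>2 * (n $ i * n $ j * H i j))"
      using eq by (simp only: mult.commute[of "\<Sum>i\<in>UNIV. (s i)\<^sup>2 * H i i"] diff_self)
    also have "\<dots> = (\<Sum>i\<in>UNIV. \<Sum>j\<in>UNIV. (s i * s j)\<^sup>2 * r (i, j))"
      by (simp add: sum_product sum_subtractf[symmetric] r_def power_mult_distrib algebra_simps)
    also have "\<dots> = (\<Sum>x\<in>UNIV. (s (fst x) * s (snd x))\<^sup>2 * r x)"
      by (simp add: sum.cartesian_product case_prod_beta)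
    \<comment> \<open>\<open>r (i, i) = 0\<close>: the diagonal cancels, so the doubled weights
      \<open>g i + g i\<close>, which nonresonance does not control, contribute no terms.\<close>
    also have "\<dots> = (\<Sum>x\<in>K. (s (fst x) * s (snd x))\<^sup>2 * r x)"
      by (rule sum.mono_neutral_right) (auto simp: K_def r_def power2_eq_square)
    also have "\<dots> = (\<Sum>P\<in>{P. card P = 2}. \<Sum>x\<in>{x \<in> K. {fst x, snd x} = P}. (s (fst x) * s (snd x))\<^sup>2 * r x)"
      by (rule sum.group[symmetric]) (auto simp: K_def)
    also have "\<dots> = (\<Sum>P\<in>{P. card P = 2}. q P * t powr (- 2 * sum g P))"
    proof (rule sum.cong[OF refl])
      fix P :: "'n set"
      have "(s (fst x) * s (snd x))\<^sup>2 = t powr (- 2 * sum g P)" if "x \<in> {x \<in> K. {fst x, snd x} = P}" for x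
      proof -
        have "sum g P = g (fst x) + g (snd x)" using that by (auto simp: K_def)
        then have "t powr (- 2 * sum g P) = t powr ((- g (fst x) + - g (snd x)) + (- g (fst x) + - g (snd x)))"
          by (simp add: algebra_simps)
        then show ?thesis unfolding powr_add s_def power2_eq_square by simp
      qed
      then show "(\<Sum>x\<in>{x \<in> K. {fst x, snd x} = P}. (s (fst x) * s (snd x))\<^sup>2 * r x) = q P * t powr (- 2 * sum g P)"
        unfolding q_def sum_distrib_right by (intro sum.cong) (auto simp: mult.commute)
    qed
    finally show "(\<Sum>P\<in>{P. card P = 2}. q P * t powr (- 2 * sum g P)) = 0" by simp
  qed simp
  moreover have "{x \<in> K. {fst x, snd x} = {a, b}} = {(a, b), (b, a)}"
    using \<open>a \<noteq> b\<close> by (auto simp: K_def doubleton_eq_iff)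
  ultimately have "r (a, b) + r (b, a) = 0" using \<open>a \<noteq> b\<close> by (simp add: q_def)
  moreover have "h (tangent_pair n a b) \<bullet> tangent_pair n a b = r (a, b) + r (b, a)"
    by (simp add: tangent_pair_def r_def diff scaleR inner_diff_left inner_diff_right H_def power2_eq_square algebra_simps)
  ultimately show ?thesis by simp
qed

text \<open>With \<open>t = exp s\<close> the orbit of \<open>p\<close> is a smooth curve inside
  \<open>S\<close>, and its velocity at \<open>s = 0\<close> is this vector.\<close>

lemma weight_field_tangent:
  fixes S :: "(real^'n::finite) set"
  assumes "p \<in> S" and inv: "\<And>t. t > 0 \<Longrightarrow> weighted_dilation g t ` S = S"
  shows "(\<chi> i. g i * p $ i) \<in> tangent_space S p"
proof -
  define \<gamma> where "\<gamma> s = (\<chi> i. exp (g i * s) * p $ i)" for s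
  define \<gamma>' where "\<gamma>' s = (\<chi> i. exp (g i * s) * (g i * p $ i))" for s
  define \<gamma>'' where "\<gamma>'' s = (\<chi> i. exp (g i * s) * (g i * (g i * p $ i)))" for s
  \<comment> \<open>Taken with the coefficients \<open>p $ i\<close> and then
    \<open>g i * p $ i\<close>, this gives both derivatives of the curve.\<close>
  have d: "((\<lambda>s. \<chi> i. exp (g i * s) * c i) has_vector_derivative (\<chi> i. exp (g i * s) * (g i * c i))) (at s)"
    for s and c :: "'n \<Rightarrow> real"
    unfolding has_vector_derivative_def
  proof (subst has_derivative_componentwise_within, intro ballI)
    fix b :: "real^'n" assume "b \<in> Basis"
    then obtain i where b: "b = axis i 1" by (auto simp: Basis_vec_def)
    have "((\<lambda>s. exp (g i * s) * c i) has_derivative (\<lambda>h. h * (exp (g i * s) * (g i * c i)))) (at s)"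
      by (auto intro!: derivative_eq_intros simp: algebra_simps)
    then show "((\<lambda>s. (\<chi> i. exp (g i * s) * c i) \<bullet> b) has_derivative
        (\<lambda>h. (h *\<^sub>R (\<chi> i. exp (g i * s) * (g i * c i))) \<bullet> b)) (at s)"
      by (simp add: b inner_axis)
  qed
  have "continuous_on UNIV \<gamma>''"
    unfolding \<gamma>''_def by (intro continuous_intros)
  then have C2: "C2_on {-1<..<1} \<gamma>"
    by (intro C2_on_vector_derivativeI[of _ _ \<gamma>' \<gamma>''])
      (auto simp: \<gamma>_def[abs_def] \<gamma>'_def[abs_def] \<gamma>''_def[abs_def] intro!: d intro: continuous_on_subset)
  have "\<gamma> s \<in> S" for s
  proof -
    have "\<gamma> s = weighted_dilation g (exp s) p"
      by (simp add: \<gamma>_def weighted_dilation_def vec_eq_iff powr_def)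
    then show ?thesis using inv[of "exp s"] \<open>p \<in> S\<close> by auto
  qed
  then have "C2_curve_at S p \<gamma>"
    unfolding C2_curve_at_def using C2 by (auto simp: \<gamma>_def vec_eq_iff intro!: exI[of _ 1])
  moreover have "velocity \<gamma> 0 = (\<chi> i. g i * p $ i)"
    using d[of "\<lambda>i. p $ i" 0] unfolding velocity_def \<gamma>_def[abs_def] by (simp add: vector_derivative_at)
  ultimately show ?thesis unfolding tangent_space_def by (metis (mono_tags, lifting) mem_Collect_eq)
qed

section \<open>The direction of the normal\<close>

text \<open>Allows identities that hold only on \<open>S\<close> to be differentiated in tangent
  directions, by the chain rule along a curve with velocity \<open>v\<close>.\<close>

lemma tangent_space_has_derivative_eq_0:
  fixes f :: "'a::euclidean_space \<Rightarrow> 'b::real_normed_vector"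
  assumes v: "v \<in> tangent_space S p" and U: "open U" "p \<in> U"
    and f: "(f has_derivative f') (at p)" and zero: "\<And>q. q \<in> S \<inter> U \<Longrightarrow> f q = 0"
  shows "f' v = 0"
proof -
  obtain \<gamma> where \<gamma>: "C2_curve_at S p \<gamma>" "velocity \<gamma> 0 = v"
    using v unfolding tangent_space_def by blast
  obtain \<epsilon> where e: "\<epsilon> > 0" "\<gamma> 0 = p" "\<And>s. \<bar>s\<bar> < \<epsilon> \<Longrightarrow> \<gamma> s \<in> S"
    "\<And>s. \<bar>s\<bar> < \<epsilon> \<Longrightarrow> (\<gamma> has_vector_derivative velocity \<gamma> s) (at s)"
    using C2_curve_atE[OF \<gamma>(1)] by metis
  have d: "(\<gamma> has_derivative (\<lambda>h. h *\<^sub>R v)) (at 0)"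
    using e(4)[of 0] e(1) \<gamma>(2) unfolding has_vector_derivative_def by simp
  have "((\<lambda>s. f (\<gamma> s)) has_derivative (\<lambda>h. f' (h *\<^sub>R v))) (at 0)"
    by (rule has_derivative_compose[OF d]) (use f e(2) in simp)
  moreover have "\<forall>\<^sub>F s in at 0. f (\<gamma> s) = 0"
  proof -
    have "(\<gamma> \<longlongrightarrow> p) (at 0)" using has_derivative_continuous[OF d] e(2) by (simp add: continuous_at)
    then have "\<forall>\<^sub>F s in at 0. \<gamma> s \<in> U" using U by (rule topological_tendstoD)
    moreover have "\<forall>\<^sub>F s in at 0. \<bar>s\<bar> < \<epsilon>"
      unfolding eventually_at using e(1) by (auto intro!: exI[of _ \<epsilon>])
    ultimately show ?thesis by eventually_elim (use e(3) zero in auto)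
  qed
  moreover have "f (\<gamma> 0) = 0" using zero[of p] e(1,2) e(3)[of 0] U(2) by simp
  ultimately have "((\<lambda>s. 0) has_derivative (\<lambda>h. f' (h *\<^sub>R v))) (at 0)"
    using has_derivative_transform_eventually[of "\<lambda>s. f (\<gamma> s)" _ 0 UNIV "\<lambda>s. 0"] by simp
  then have "(\<lambda>h. f' (h *\<^sub>R v)) = (\<lambda>h. 0)"
    using has_derivative_unique[OF has_derivative_const] by metis
  from fun_cong[OF this, of 1] show ?thesis by simp
qed

text \<open>A third index \<open>c\<close> turns \<open>g a = g b\<close> into a collision between
  the sums over \<open>{a, c}\<close> and \<open>{b, c}\<close>.\<close>

lemma pair_sum_nonresonant_inj:
  fixes g :: "'n::finite \<Rightarrow> real"
  assumes "CARD('n) \<ge> 3" "pair_sum_nonresonant g"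
  shows "inj g"
proof (rule injI, rule ccontr)
  fix a b assume eq: "g a = g b" and "a \<noteq> b"
  have "card {a, b} \<le> 2" by (simp add: card_insert_if)
  then have "{a, b} \<noteq> UNIV" using assms(1) by auto
  then obtain c where c: "c \<noteq> a" "c \<noteq> b" by blast
  have "sum g {a, c} = sum g {b, c}" using eq c by simp
  moreover have "{a, c} \<in> {P. card P = 2}" "{b, c} \<in> {P. card P = 2}" using c by auto
  ultimately have "{a, c} = {b, c}" by (rule inj_onD[OF assms(2)[unfolded pair_sum_nonresonant_def]])
  then show False using \<open>a \<noteq> b\<close> c by (auto simp: doubleton_eq_iff)
qed

lemma inner_tangent_pair [simp]:
  "x \<bullet> tangent_pair n i j = n $ j * x $ i - n $ i * x $ j"
  by (simp add: tangent_pair_def inner_diff_right inner_axis)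

text \<open>Linear algebra at one point: \<open>n\<close> and \<open>h\<close> stand for normal and
  Hessian, \<open>x\<close> for the weight field, and \<open>weight\<close> for the derivative of
  their orthogonality. The null directions make \<open>h (W b)\<close> orthogonal to every tangent
  vector, in particular to \<open>x\<close>; then \<open>weight\<close> at \<open>W b\<close> reads
  \<open>(g b - g a) * n $ a * n $ b = 0\<close>.\<close>

lemma weights_eq_if_tangent_pairs_null:
  fixes n x :: "real^'n::finite"
  assumes lin: "linear h" and sym: "\<And>u v. h u \<bullet> v = h v \<bullet> u"
    and null: "\<And>i j. i \<noteq> j \<Longrightarrow> h (tangent_pair n i j) \<bullet> tangent_pair n i j = 0"
    and vanish: "\<And>k v. n $ k = 0 \<Longrightarrow> n \<bullet> v = 0 \<Longrightarrow> h v $ k = 0"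
    and x: "n \<bullet> x = 0"
    and weight: "\<And>v. n \<bullet> v = 0 \<Longrightarrow> h v \<bullet> x + n \<bullet> (\<chi> i. g i * v $ i) = 0"
    and ab: "n $ a \<noteq> 0" "n $ b \<noteq> 0"
  shows "g a = g b"
proof (cases "a = b")
  case False
  interpret linear h by fact
  \<comment> \<open>Since \<open>n $ a \<noteq> 0\<close>, the \<open>W k\<close> with
    \<open>k \<noteq> a\<close> form a basis of the hyperplane orthogonal to \<open>n\<close>, while
    \<open>W a = 0\<close>.\<close>
  define W where "W k = tangent_pair n k a" for k
  have nW: "n \<bullet> W k = 0" for k by (simp add: W_def)
  have WW: "h (W b) \<bullet> W k = 0" for k
  proof -
    consider "k = a" | "k = b" | "n $ k = 0" | "k \<noteq> a" "k \<noteq> b" "n $ k \<noteq> 0" by blast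
    then show ?thesis
    proof cases
      case 1
      then show ?thesis by (simp add: W_def)
    next
      case 2
      then show ?thesis using null[of b a] False by (simp add: W_def)
    next
      case 3
      then show ?thesis using vanish[OF 3 nW[of b]] by (simp add: W_def)
    next
      case 4
      \<comment> \<open>Polarization: \<open>W k\<close>, \<open>W b\<close> and this combination of
        them are all null for \<open>h\<close>, which leaves only the mixed term, with a nonzero
        coefficient.\<close>
      have Z: "n $ a *\<^sub>R tangent_pair n k b = n $ b *\<^sub>R W k - n $ k *\<^sub>R W b"
        by (simp add: W_def tangent_pair_def algebra_simps)
      have "0 = h (n $ a *\<^sub>R tangent_pair n k b) \<bullet> (n $ a *\<^sub>R tangent_pair n k b)"
        using null[of k b] 4 by (simp add: scaleR del: inner_tangent_pair)
      also have "\<dots> = (n $ b)\<^sup>2 * (h (W k) \<bullet> W k) + (n $ k)\<^sup>2 * (h (W b) \<bullet> W b) -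
          2 * n $ b * n $ k * (h (W b) \<bullet> W k)"
        unfolding Z using sym[of "W k" "W b"]
        by (simp add: diff scaleR inner_diff_left inner_diff_right power2_eq_square algebra_simps)
      finally show ?thesis
        using null[of k a] null[of b a] 4 ab False by (simp add: W_def del: inner_tangent_pair)
    qed
  qed
  \<comment> \<open>The sum reproduces \<open>x\<close> up to a multiple of
    \<open>n \<bullet> x\<close>, which is zero.\<close>
  have "x = (\<Sum>k\<in>UNIV. (x $ k / n $ a) *\<^sub>R W k)"
  proof -
    have "(\<Sum>k\<in>UNIV. (x $ k / n $ a) *\<^sub>R W k) =
        (\<Sum>k\<in>UNIV. x $ k *\<^sub>R axis k 1 - (n $ k * x $ k / n $ a) *\<^sub>R axis a 1)"
      using ab by (intro sum.cong) (auto simp: W_def tangent_pair_def scaleR_diff_right mult.commute)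
    also have "\<dots> = (\<Sum>k\<in>UNIV. x $ k *\<^sub>R axis k 1) - ((n \<bullet> x) / n $ a) *\<^sub>R axis a 1"
      by (simp add: sum_subtractf scaleR_left.sum sum_divide_distrib inner_vec_def)
    also have "\<dots> = x" using basis_expansion[of x] x by (simp add: scalar_mult_eq_scaleR)
    finally show ?thesis by simp
  qed
  then have "h (W b) \<bullet> x = (\<Sum>k\<in>UNIV. (x $ k / n $ a) * (h (W b) \<bullet> W k))"
    by (metis (no_types, lifting) inner_scaleR_right inner_sum_right sum.cong)
  then have "h (W b) \<bullet> x = 0" by (simp add: WW)
  then have "n \<bullet> (\<chi> i. g i * W b $ i) = 0" using weight[OF nW[of b]] by simp
  moreover have "(\<chi> i. g i * W b $ i) = (g b * n $ a) *\<^sub>R axis b 1 - (g a * n $ b) *\<^sub>R axis a 1"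
    by (simp add: W_def tangent_pair_def vec_eq_iff axis_def)
  ultimately show ?thesis using ab by (simp add: inner_diff_right inner_axis)
qed simp

section \<open>Relative openness in a hyperplane\<close>

text \<open>Invariance of domain: near \<open>p\<close> the set is the image of an open part of the
  slice hyperplane under the continuous injection \<open>\<psi>\<close>, into a subspace of the same
  dimension.\<close>

lemma embedded_C2_hypersurface_openin_subspace:
  fixes S :: "'a::euclidean_space set"
  assumes emb: "embedded_C2_hypersurface S" and P: "subspace P" "dim P = DIM('a) - 1" "S \<subseteq> P"
  shows "openin (top_of_set P) S"
proof (subst openin_subopen, intro ballI)
  fix p assume "p \<in> S"
  then obtain U and V :: "'a set" and \<phi> \<psi> k where k: "k \<in> Basis" and U: "open U" "p \<in> U" and V: "open V"
    and hom: "homeomorphism U V \<phi> \<psi>" and img: "\<phi> ` (S \<inter> U) = {y \<in> V. y \<bullet> k = 0}"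
    using emb unfolding embedded_C2_hypersurface_def by meson
  define Q where "Q = {y. k \<bullet> y = 0}"
  have \<psi>img: "\<psi> ` (Q \<inter> V) = S \<inter> U"
  proof -
    have "Q \<inter> V = \<phi> ` (S \<inter> U)" unfolding img Q_def by (auto simp: inner_commute)
    then show ?thesis using hom by (force simp: homeomorphism_def image_image)
  qed
  have "openin (top_of_set P) (\<psi> ` (Q \<inter> V))"
  proof (rule invariance_of_domain_subspaces)
    show "openin (top_of_set Q) (Q \<inter> V)" using V by blast
    show "subspace Q" unfolding Q_def by (rule subspace_hyperplane)
    have "k \<noteq> 0" using k by auto
    then show "dim P \<le> dim Q" unfolding Q_def P(2) by (simp add: dim_hyperplane)
    show "continuous_on (Q \<inter> V) \<psi>"
      using hom unfolding homeomorphism_def by (meson continuous_on_subset inf_le2)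
    show "\<psi> \<in> Q \<inter> V \<rightarrow> P" using \<psi>img P(3) by blast
    show "inj_on \<psi> (Q \<inter> V)"
      using hom unfolding homeomorphism_def by (metis IntD2 inj_on_inverseI)
  qed (rule P(1))
  then show "\<exists>T. openin (top_of_set P) T \<and> p \<in> T \<and> T \<subseteq> S"
    unfolding \<psi>img using \<open>p \<in> S\<close> U(2) by blast
qed

section \<open>Counting the nonzero components of the normal\<close>

text \<open>The normal \<open>n\<close> depends on a chart, the tangent space does not. This makes
  the zero pattern of the normal intrinsic, so that distant points can be compared.\<close>

lemma curvature_data_axis_tangent:
  fixes S :: "(real^'n::finite) set"
  shows "curvature_data S p n h \<Longrightarrow> axis i 1 \<in> tangent_space S p \<longleftrightarrow> n $ i = 0"
  by (simp add: curvature_data_def inner_axis)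

lemma nonzero_components_open:
  fixes N :: "'a::real_normed_vector \<Rightarrow> real^'n::finite"
  assumes "open U" "\<And>x. x \<in> U \<Longrightarrow> (N has_derivative H x) (at x)"
  shows "open {x \<in> U. \<forall>k\<in>K. N x $ k \<noteq> 0}"
proof -
  have "continuous_on U (\<lambda>x. N x $ k)" for k
    using assms(2) by (intro continuous_intros continuous_at_imp_continuous_on ballI has_derivative_continuous)
  then have "open (U \<inter> (\<lambda>x. N x $ k) -` (- {0}))" for k
    by (intro continuous_open_preimage assms(1)) auto
  then have "open (U \<inter> (\<Inter>k\<in>K. U \<inter> (\<lambda>x. N x $ k) -` (- {0})))"
    using assms(1) by (intro open_Int open_INT) auto
  also have "(U \<inter> (\<Inter>k\<in>K. U \<inter> (\<lambda>x. N x $ k) -` (- {0}))) = {x \<in> U. \<forall>k\<in>K. N x $ k \<noteq> 0}" by auto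
  finally show ?thesis .
qed

text \<open>A bound at a point where the count is largest is a bound everywhere, and at such a point
  maximality makes the zero pattern of the normal constant nearby on \<open>S\<close>.\<close>

lemma minimal_dilation_invariant_normal_axis:
  fixes S :: "(real^'n::finite) set"
  assumes emb: "embedded_C2_hypersurface S" and min: "minimal_hypersurface S"
    and inv: "\<And>t. t > 0 \<Longrightarrow> weighted_dilation g t ` S = S"
    and nonres: "pair_sum_nonresonant g" and inj: "inj g" and "q \<in> S"
  shows "card {i. axis i 1 \<notin> tangent_space S q} \<le> 1"
proof -
  define I where "I q = {i. axis i 1 \<notin> tangent_space S q}" for q
  define m where "m = Max ((card \<circ> I) ` S)"
  have fin: "finite ((card \<circ> I) ` S)"
    by (rule finite_subset[of _ "{..CARD('n)}"]) (auto intro: card_mono)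
  then have "m \<in> (card \<circ> I) ` S" unfolding m_def using \<open>q \<in> S\<close> by (intro Max_in) auto
  then obtain p where p: "p \<in> S" "card (I p) = m" by auto
  have max: "card (I x) \<le> card (I p)" if "x \<in> S" for x
    unfolding p m_def using fin that by (intro Max_ge) auto
  obtain U N H where U: "open U" "p \<in> U" and N: "\<And>x. x \<in> U \<Longrightarrow> (N has_derivative H x) (at x)"
    and data: "\<And>x. x \<in> S \<inter> U \<Longrightarrow> curvature_data S x (N x) (H x)"
    using embedded_C2_hypersurface_local_curvature_data[OF emb p(1)] by blast
  have I: "I x = {i. N x $ i \<noteq> 0}" if "x \<in> S \<inter> U" for x
    unfolding I_def using curvature_data_axis_tangent[OF data[OF that]] by simp
  define U' where "U' = {x \<in> U. \<forall>k\<in>I p. N x $ k \<noteq> 0}"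
  have U': "open U'" "p \<in> U'"
    unfolding U'_def using nonzero_components_open[OF U(1) N] by blast (use I[of p] p(1) U(2) in auto)
  have const: "N x $ k = 0" if "x \<in> S \<inter> U'" "N p $ k = 0" for x k
  proof -
    have x: "x \<in> S \<inter> U" using that by (auto simp: U'_def)
    have "I p \<subseteq> I x" using that(1) I[OF x] by (auto simp: U'_def)
    \<comment> \<open>Nonzero components stay nonzero on \<open>U'\<close>, and maximality forbids
      new ones.\<close>
    then have "I p = I x" using max[of x] x by (intro card_seteq) auto
    then show ?thesis using I[OF x] I[of p] that(2) p(1) U(2) by auto
  qed
  define X where "X x = (\<chi> i. g i * x $ i)" for x :: "real^'n"
  have X: "bounded_linear X"
    unfolding X_def by (intro linear_conv_bounded_linear[THEN iffD1] linearI) (auto simp: vec_eq_iff algebra_simps)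
  have dp: "curvature_data S p (N p) (H p)" using data p(1) U(2) by blast
  then have T: "tangent_space S p = {v. N p \<bullet> v = 0}" and lin: "linear (H p)"
    and sym: "\<And>u v. H p u \<bullet> v = H p v \<bullet> u"
    unfolding curvature_data_def by auto
  have NX: "N x \<bullet> X x = 0" if "x \<in> S \<inter> U" for x
    using weight_field_tangent[OF _ inv, of x] data[OF that] that unfolding X_def curvature_data_def by auto
  have "g a = g b" if "a \<in> I p" "b \<in> I p" for a b
  proof (rule weights_eq_if_tangent_pairs_null[OF lin sym])
    show "H p (tangent_pair (N p) i j) \<bullet> tangent_pair (N p) i j = 0" if "i \<noteq> j" for i j
      using min that unfolding minimal_hypersurface_def
      by (intro tangent_pair_null[OF dp p(1) nonres inv]) auto
    \<comment> \<open>The \<open>k\<close>-th component of \<open>N\<close> is zero on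
      \<open>S\<close> near \<open>p\<close>, so its tangential derivatives vanish.\<close>
    show "H p v $ k = 0" if "N p $ k = 0" "N p \<bullet> v = 0" for k v
    proof (rule tangent_space_has_derivative_eq_0[where f = "\<lambda>x. N x $ k" and f' = "\<lambda>v. H p v $ k", OF _ U'])
      show "v \<in> tangent_space S p" using that T by simp
      show "((\<lambda>x. N x $ k) has_derivative (\<lambda>v. H p v $ k)) (at p)"
        by (intro bounded_linear.has_derivative[OF bounded_linear_vec_nth] N U)
    qed (use const that in blast)
    show "N p \<bullet> X p = 0" using NX p(1) U(2) by blast
    show "H p v \<bullet> X p + N p \<bullet> (\<chi> i. g i * v $ i) = 0" if "N p \<bullet> v = 0" for v
    proof -
      \<comment> \<open>Product rule for \<open>N x \<bullet> X x = 0\<close>, where the linear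
        field \<open>X\<close> is its own derivative.\<close>
      have "N p \<bullet> X v + H p v \<bullet> X p = 0"
      proof (rule tangent_space_has_derivative_eq_0[where f = "\<lambda>x. N x \<bullet> X x"
            and f' = "\<lambda>v. N p \<bullet> X v + H p v \<bullet> X p", OF _ U])
        show "v \<in> tangent_space S p" using that T by simp
        show "((\<lambda>x. N x \<bullet> X x) has_derivative (\<lambda>v. N p \<bullet> X v + H p v \<bullet> X p)) (at p)"
          by (intro has_derivative_inner N U bounded_linear_imp_has_derivative X)
      qed (use NX in blast)
      then show ?thesis by (simp add: X_def)
    qed
    show "N p $ a \<noteq> 0" "N p $ b \<noteq> 0" using that I[of p] p(1) U(2) by auto
  qed
  then have "\<forall>a\<in>I p. \<forall>b\<in>I p. a = b" using inj by (meson injD)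
  then have "card (I p) \<le> 1" by (simp add: card_le_Suc0_iff_eq)
  then show ?thesis using max[OF \<open>q \<in> S\<close>] by (simp add: I_def)
qed

section \<open>From a single normal axis at each point to one coordinate hyperplane\<close>

theorem corollary3p10:
  fixes g :: "'n::finite \<Rightarrow> real" and \<Sigma> :: "(real^'n) set"
  assumes "CARD('n) \<ge> 3"
    and "\<And>i. g i > 0"
    and "pair_sum_nonresonant g"
    and "embedded_C2_hypersurface \<Sigma>"
    and "connected \<Sigma>"
    and "minimal_hypersurface \<Sigma>"
    and "\<And>t. t > 0 \<Longrightarrow> weighted_dilation g t ` \<Sigma> = \<Sigma>"
  shows "\<exists>i. connected \<Sigma> \<and> openin (top_of_set {x :: real^'n. x $ i = 0}) \<Sigma>"
proof -
  define I where "I p = {i. axis i 1 \<notin> tangent_space \<Sigma> p}" for p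
  have unique: "i = j" if "p \<in> \<Sigma>" "i \<in> I p" "j \<in> I p" for p i j
    using minimal_dilation_invariant_normal_axis[OF assms(4,6,7,3) pair_sum_nonresonant_inj[OF assms(1,3)] that(1)] that(2,3)
    unfolding I_def by (auto simp: card_le_Suc0_iff_eq)
  have nonempty: "\<exists>i. i \<in> I p" and openI: "\<exists>W. open W \<and> p \<in> W \<and> (\<forall>x\<in>\<Sigma> \<inter> W. I p \<subseteq> I x)"
    and zero: "I p = {i} \<Longrightarrow> p $ i = 0" if p: "p \<in> \<Sigma>" for p i
  proof -
    obtain U N H where U: "open U" "p \<in> U" and N: "\<And>x. x \<in> U \<Longrightarrow> (N has_derivative H x) (at x)"
      and data: "\<And>x. x \<in> \<Sigma> \<inter> U \<Longrightarrow> curvature_data \<Sigma> x (N x) (H x)"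
      using embedded_C2_hypersurface_local_curvature_data[OF assms(4) p] by blast
    have I: "I x = {i. N x $ i \<noteq> 0}" if "x \<in> \<Sigma> \<inter> U" for x
      unfolding I_def using curvature_data_axis_tangent[OF data[OF that]] by simp
    have dp: "curvature_data \<Sigma> p (N p) (H p)" using data p U(2) by blast
    then have "N p \<noteq> 0" unfolding curvature_data_def by blast
    then show "\<exists>i. i \<in> I p" using I[of p] p U(2) by (auto simp: vec_eq_iff)
    show "\<exists>W. open W \<and> p \<in> W \<and> (\<forall>x\<in>\<Sigma> \<inter> W. I p \<subseteq> I x)"
      using nonzero_components_open[OF U(1) N, of "I p"] I p U(2)
      by (intro exI[of _ "{x \<in> U. \<forall>k\<in>I p. N x $ k \<noteq> 0}"]) auto
    assume "I p = {i}"
    then have Ni: "N p $ j = 0 \<longleftrightarrow> j \<noteq> i" for j using I[of p] p U(2) by auto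
    \<comment> \<open>Only the \<open>i\<close>-th term of the tangency relation survives;
      \<open>g i\<close> and \<open>N p $ i\<close> are nonzero, which leaves
      \<open>p $ i = 0\<close>.\<close>
    have "0 = N p \<bullet> (\<chi> i. g i * p $ i)"
      using weight_field_tangent[OF p assms(7)] dp unfolding curvature_data_def by auto
    also have "\<dots> = (\<Sum>j\<in>{i}. N p $ j * (g j * p $ j))"
      unfolding inner_vec_def using Ni by (intro sum.mono_neutral_cong_right) auto
    finally show "p $ i = 0" using Ni[of i] assms(2)[of i] by simp
  qed
  obtain p0 where p0: "p0 \<in> \<Sigma>" using assms(4) unfolding embedded_C2_hypersurface_def by blast
  obtain i where i: "i \<in> I p0" using nonempty[OF p0] by blast
  \<comment> \<open>Nonzero components persist nearby. Taking \<open>J\<close> to be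
    \<open>{i}\<close> and then its complement shows that the points with axis \<open>i\<close> form
    a clopen subset of \<open>\<Sigma>\<close>.\<close>
  have op: "openin (top_of_set \<Sigma>) {p \<in> \<Sigma>. \<exists>j\<in>J. j \<in> I p}" for J
  proof (subst openin_subopen, intro ballI)
    fix p assume p: "p \<in> {p \<in> \<Sigma>. \<exists>j\<in>J. j \<in> I p}"
    then obtain W where "open W" "p \<in> W" "\<forall>x\<in>\<Sigma> \<inter> W. I p \<subseteq> I x" using openI by blast
    then show "\<exists>T. openin (top_of_set \<Sigma>) T \<and> p \<in> T \<and> T \<subseteq> {p \<in> \<Sigma>. \<exists>j\<in>J. j \<in> I p}"
      using p by (intro exI[of _ "\<Sigma> \<inter> W"]) auto
  qed
  have "{p \<in> \<Sigma>. i \<in> I p} = \<Sigma>"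
  proof -
    have "{p \<in> \<Sigma>. \<exists>j\<in>-{i}. j \<in> I p} = \<Sigma> - {p \<in> \<Sigma>. i \<in> I p}"
      using unique nonempty by blast
    then have "closedin (top_of_set \<Sigma>) {p \<in> \<Sigma>. i \<in> I p}"
      using op[of "-{i}"] by (simp add: closedin_def)
    moreover have "openin (top_of_set \<Sigma>) {p \<in> \<Sigma>. i \<in> I p}" using op[of "{i}"] by simp
    moreover have "{p \<in> \<Sigma>. i \<in> I p} \<noteq> {}" using p0 i by blast
    ultimately show ?thesis using assms(5) unfolding connected_clopen by blast
  qed
  then have "I p = {i}" if "p \<in> \<Sigma>" for p using unique that by blast
  then have "\<Sigma> \<subseteq> {x. x $ i = 0}" using zero by blast
  moreover have plane: "{x :: real^'n. x $ i = 0} = {x. axis i 1 \<bullet> x = 0}" by (simp add: inner_axis')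
  ultimately have "openin (top_of_set {x :: real^'n. x $ i = 0}) \<Sigma>"
    unfolding plane
    by (intro embedded_C2_hypersurface_openin_subspace assms(4) subspace_hyperplane dim_hyperplane) (auto simp: axis_eq_0_iff)
  then show ?thesis using assms(5) by blast
qed

end
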